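(* Let $(M,\sigma)$ be a hyperbolic surface of genus $\geq 2$ and total area $A$. Then there exists a positive constant $C = C(\sigma)$ such that for any smooth function $u\colon M \to \mathbb{R}$ for which $g = e^{2u}\sigma$ is a metric of nonpositive Gaussian curvature and total area $A$, we have $u(x)\leq C$ for every $x\in M$.
   Context: $M$ is a smooth closed surface. A hyperbolic metric is a Riemannian metric of constant Gaussian curvature $-1$; a hyperbolic surface is a surface equipped with a hyperbolic metric. $C(\sigma)$ means the constant depends only on $\sigma$ (not on $u$). *)

theory Defs
  imports "HOL-Analysis.Analysis"
begin

section \<open>Smooth maps on open subsets of the plane\<close>

definition partial :: "2 \<Rightarrow> (real^2 \<Rightarrow> 'b::real_normed_vector) \<Rightarrow> real^2 \<Rightarrow> 'b" where
  "partial i f x = frechet_derivative f (at x) (axis i 1)"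

primrec Ck_on :: "nat \<Rightarrow> (real^2) set \<Rightarrow> (real^2 \<Rightarrow> 'b::real_normed_vector) \<Rightarrow> bool" where
  "Ck_on 0 S f \<longleftrightarrow> continuous_on S f"
| "Ck_on (Suc k) S f \<longleftrightarrow>
     (\<forall>x\<in>S. f differentiable (at x)) \<and> (\<forall>i. Ck_on k S (partial i f))"

text \<open>Only used for open \<open>S\<close>, so that derivatives at points of \<open>S\<close> do not depend on the
  values of \<open>f\<close> outside \<open>S\<close>.\<close>

definition smooth_on :: "(real^2) set \<Rightarrow> (real^2 \<Rightarrow> 'b::real_normed_vector) \<Rightarrow> bool" where
  "smooth_on S f \<longleftrightarrow> (\<forall>k. Ck_on k S f)"


section \<open>Smooth closed surfaces\<close>

text \<open>A chart \<open>(U, \<phi>)\<close> consists of its domain and its coordinate map; the values of \<open>\<phi>\<close>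
  outside \<open>U\<close> are irrelevant. A surface is a subset \<open>M\<close> of a Hausdorff space, with the
  subspace topology, together with an atlas \<open>S\<close>, which need not be maximal. There is no
  boundary because charts are onto open subsets of the plane.\<close>

type_synonym 'a chart = "'a set \<times> ('a \<Rightarrow> real^2)"

abbreviation dom_of :: "'a chart \<Rightarrow> 'a set" where "dom_of c \<equiv> fst c"
abbreviation coord :: "'a chart \<Rightarrow> 'a \<Rightarrow> real^2" where "coord c \<equiv> snd c"
abbreviation image_of :: "'a chart \<Rightarrow> (real^2) set" where "image_of c \<equiv> coord c ` dom_of c"

definition in_chart :: "'a chart \<Rightarrow> ('a \<Rightarrow> 'b) \<Rightarrow> real^2 \<Rightarrow> 'b" where
  "in_chart c f = f \<circ> inv_into (dom_of c) (coord c)"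

definition is_chart :: "'a::topological_space set \<Rightarrow> 'a chart \<Rightarrow> bool" where
  "is_chart M c \<longleftrightarrow> openin (top_of_set M) (dom_of c) \<and> open (image_of c) \<and>
     homeomorphism (dom_of c) (image_of c) (coord c) (inv_into (dom_of c) (coord c))"

definition smooth_atlas :: "'a::topological_space set \<Rightarrow> 'a chart set \<Rightarrow> bool" where
  "smooth_atlas M S \<longleftrightarrow> (\<forall>c\<in>S. is_chart M c) \<and> (\<Union>c\<in>S. dom_of c) = M \<and>
     (\<forall>c\<in>S. \<forall>d\<in>S. smooth_on (coord c ` (dom_of c \<inter> dom_of d)) (in_chart c (coord d)))"

definition closed_surface :: "'a::t2_space set \<Rightarrow> 'a chart set \<Rightarrow> bool" where
  "closed_surface M S \<longleftrightarrow> compact M \<and> connected M \<and> smooth_atlas M S"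

definition smooth_function :: "'a chart set \<Rightarrow> ('a \<Rightarrow> real) \<Rightarrow> bool" where
  "smooth_function S u \<longleftrightarrow> (\<forall>c\<in>S. smooth_on (image_of c) (in_chart c u))"

text \<open>The genus is the largest number of pairwise disjoint simple closed curves whose union
  does not disconnect the surface. For non-orientable surfaces this is the number of
  cross-caps.\<close>

definition simple_closed_curve :: "'a::topological_space set \<Rightarrow> bool" where
  "simple_closed_curve C \<longleftrightarrow>
     (\<exists>\<gamma>. simple_path \<gamma> \<and> pathfinish \<gamma> = pathstart \<gamma> \<and> path_image \<gamma> = C)"

definition genus :: "'a::topological_space set \<Rightarrow> enat" where
  "genus M = Sup {enat (card F) | F. finite F \<and> disjoint F \<and>
     (\<forall>C\<in>F. simple_closed_curve C \<and> C \<subseteq> M) \<and> connected (M - \<Union>F)}"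


section \<open>Riemannian metrics\<close>

text \<open>A tensor field is given by its components: \<open>g c p\<close> is the matrix of \<open>g\<close> at the point
  \<open>p\<close> with respect to the coordinate basis of the chart \<open>c\<close>. The last clause of
  \<open>riemannian_metric\<close> is the transformation law under change of charts.\<close>

type_synonym 'a metric_field = "'a chart \<Rightarrow> 'a \<Rightarrow> real^2^2"

definition jacobian :: "'a chart \<Rightarrow> 'a chart \<Rightarrow> 'a \<Rightarrow> real^2^2" where
  "jacobian c d p = matrix (frechet_derivative (in_chart c (coord d)) (at (coord c p)))"

definition riemannian_metric :: "'a chart set \<Rightarrow> 'a metric_field \<Rightarrow> bool" where
  "riemannian_metric S g \<longleftrightarrow>
     (\<forall>c\<in>S. smooth_on (image_of c) (in_chart c (g c))) \<and>
     (\<forall>c\<in>S. \<forall>p\<in>dom_of c. transpose (g c p) = g c p \<and>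
        (\<forall>v. v \<noteq> 0 \<longrightarrow> v \<bullet> (g c p *v v) > 0)) \<and>
     (\<forall>c\<in>S. \<forall>d\<in>S. \<forall>p\<in>dom_of c \<inter> dom_of d.
        g c p = transpose (jacobian c d p) ** g d p ** jacobian c d p)"

definition conformal_metric :: "('a \<Rightarrow> real) \<Rightarrow> 'a metric_field \<Rightarrow> 'a metric_field" where
  "conformal_metric u \<sigma> = (\<lambda>c p. exp (2 * u p) *\<^sub>R \<sigma> c p)"


section \<open>Gaussian curvature\<close>

text \<open>Here \<open>G\<close> is the matrix of the metric as a function of the coordinates.
  \<open>christoffel G k i j\<close> is \<open>\<Gamma>\<close> with upper index \<open>k\<close>, and \<open>riemann G l i j k\<close> is the
  \<open>l\<close>-th component of \<open>R(\<partial>\<^sub>i, \<partial>\<^sub>j)\<partial>\<^sub>k\<close>, where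
  \<open>R(X, Y)Z = \<nabla>\<^sub>X\<nabla>\<^sub>YZ - \<nabla>\<^sub>Y\<nabla>\<^sub>XZ - \<nabla>\<^bsub>[X, Y]\<^esub>Z\<close>. The curvature is
  \<open>\<langle>R(\<partial>\<^sub>1, \<partial>\<^sub>2)\<partial>\<^sub>2, \<partial>\<^sub>1\<rangle> / det G\<close>.\<close>

definition christoffel :: "(real^2 \<Rightarrow> real^2^2) \<Rightarrow> 2 \<Rightarrow> 2 \<Rightarrow> 2 \<Rightarrow> real^2 \<Rightarrow> real" where
  "christoffel G k i j x = (1/2) * (\<Sum>l\<in>UNIV. matrix_inv (G x) $ k $ l *
     (partial i (\<lambda>y. G y $ j $ l) x + partial j (\<lambda>y. G y $ i $ l) x
        - partial l (\<lambda>y. G y $ i $ j) x))"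

definition riemann :: "(real^2 \<Rightarrow> real^2^2) \<Rightarrow> 2 \<Rightarrow> 2 \<Rightarrow> 2 \<Rightarrow> 2 \<Rightarrow> real^2 \<Rightarrow> real" where
  "riemann G l i j k x =
     partial i (christoffel G l j k) x - partial j (christoffel G l i k) x
     + (\<Sum>m\<in>UNIV. christoffel G l i m x * christoffel G m j k x
                  - christoffel G l j m x * christoffel G m i k x)"

definition gauss_curvature :: "'a metric_field \<Rightarrow> 'a chart \<Rightarrow> 'a \<Rightarrow> real" where
  "gauss_curvature g c p = (let G = in_chart c (g c); x = coord c p in
     (\<Sum>l\<in>UNIV. G x $ 1 $ l * riemann G l 1 2 2 x) / det (G x))"

text \<open>The value of \<open>gauss_curvature\<close> does not depend on the chart, so requiring a condition in
  all charts around a point is the same as requiring it in one of them.\<close>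

definition hyperbolic_metric :: "'a chart set \<Rightarrow> 'a metric_field \<Rightarrow> bool" where
  "hyperbolic_metric S \<sigma> \<longleftrightarrow> riemannian_metric S \<sigma> \<and>
     (\<forall>c\<in>S. \<forall>p\<in>dom_of c. gauss_curvature \<sigma> c p = -1)"

definition nonpositively_curved :: "'a chart set \<Rightarrow> 'a metric_field \<Rightarrow> bool" where
  "nonpositively_curved S g \<longleftrightarrow> (\<forall>c\<in>S. \<forall>p\<in>dom_of c. gauss_curvature g c p \<le> 0)"


section \<open>Area\<close>

definition chart_area :: "'a metric_field \<Rightarrow> 'a chart \<Rightarrow> 'a set \<Rightarrow> ennreal" where
  "chart_area g c E =
     (\<integral>\<^sup>+x. ennreal (sqrt (det (in_chart c (g c) x))) * indicator (coord c ` E) x \<partial>lborel)"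

text \<open>The Riemannian area of a Borel set \<open>B\<close>. Since \<open>chart_area\<close> is countably additive and
  does not depend on the chart, the supremum over finite disjoint families of Borel pieces,
  each inside one chart, is attained by every such family that partitions \<open>B\<close>.\<close>

definition area :: "'a::topological_space set \<Rightarrow> 'a chart set \<Rightarrow> 'a metric_field \<Rightarrow> 'a set \<Rightarrow> ennreal"
  where
  "area M S g B = Sup {\<Sum>i<n. chart_area g (c i) (E i) | (n::nat) c E.
     disjoint_family_on E {..<n} \<and>
     (\<forall>i<n. c i \<in> S \<and> E i \<in> sets (restrict_space borel M) \<and> E i \<subseteq> B \<inter> dom_of (c i))}"

end

theory Submission
  imports Defs
begin

text \<open>For \<open>f = e\<^sup>2\<^sup>u\<close> the formula \<open>K\<^sub>g = e\<^sup>-\<^sup>2\<^sup>u (-1 - \<Delta>u)\<close> turns \<open>K\<^sub>g \<le> 0\<close> into \<open>\<Delta>u \<ge> -1\<close>, hence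
  \<open>\<Delta>f \<ge> -2f\<close>, while the area condition bounds the integral of \<open>f\<close> over a coordinate disc. Let \<open>f\<close>
  attain its maximum \<open>F\<close> at \<open>x\<^sub>0\<close>. Testing \<open>\<Delta>f \<ge> -2f\<close> in a chart against a regularised and truncated
  logarithm of the quadratic form of \<open>\<sigma>(x\<^sub>0)\<close>, which solves the equation with coefficients frozen at
  \<open>x\<^sub>0\<close> up to a bounded term, bounds \<open>F\<close> by a multiple of the integral of \<open>f\<close> over a disc of radius \<open>r\<close>
  plus error terms of the form \<open>\<integral> f / \<bar>x - x\<^sub>0\<bar>\<close>. Since \<open>f \<le> F\<close>, these errors are at most a multiple of
  \<open>F r\<close>, so for small \<open>r\<close> they are absorbed into the left hand side. All constants are uniform for
  \<open>x\<^sub>0\<close> in a small disc, and finitely many discs cover \<open>M\<close>.\<close>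

section \<open>Partial derivatives and their integrals\<close>

text \<open>The obstacle is that the charts are arbitrary: in them the metric need not be conformal
  to the flat one, so flat mean value formulas do not apply. Dimension two helps: the Laplacian
  times the area density is \<open>div (A grad f)\<close> with \<open>det A = 1\<close>, and for a
  constant such \<open>A\<close> the logarithm of the quadratic form of its adjugate is annihilated
  off the pole. Freezing \<open>A\<close> at \<open>x0\<close> costs a factor |x - x0|, by a
  Lipschitz bound, against second derivatives of size |x - x0|^-2; this leaves the integrable
  singularity 1/|x - x0|, whose integral over a disc of radius r is of order r. The same singularity
  bounds the logarithm itself, so all errors have one form. The regularisation parameter \<epsilon>
  is not sent to 0. It is fixed once, in terms of the continuity of f at its maximum, so that f is
  at least F/2 on a tiny disc. The area of that disc is proportional to \<epsilon> and the test
  function contributes a density of order 1/\<epsilon> there, so \<epsilon> cancels and no modulus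
  of continuity of u enters the constant.\<close>

definition has_partial :: "2 \<Rightarrow> (real^2 \<Rightarrow> real) \<Rightarrow> real \<Rightarrow> real^2 \<Rightarrow> bool" where
  "has_partial i f d x \<longleftrightarrow> ((\<lambda>t. f (x + t *\<^sub>R axis i 1)) has_real_derivative d) (at 0)"

lemma has_partial_line:
  assumes "has_partial i f d (x + s *\<^sub>R axis i 1)"
  shows "((\<lambda>t. f (x + t *\<^sub>R axis i 1)) has_real_derivative d) (at s)"
proof -
  have "((\<lambda>t. f (x + (t + s) *\<^sub>R axis i 1)) has_real_derivative d) (at 0)"
    using assms unfolding has_partial_def by (simp add: algebra_simps)
  then show ?thesis
    using DERIV_shift[of "\<lambda>t. f (x + t *\<^sub>R axis i 1)" d 0 s] by simp
qed

lemma has_partial_partial: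
  assumes "f differentiable (at x)"
  shows "has_partial i f (partial i f x) x"
proof -
  have "(f has_derivative frechet_derivative f (at x)) (at x)"
    using assms frechet_derivative_works by blast
  then have "(f has_derivative frechet_derivative f (at x)) (at (x + 0 *\<^sub>R axis i 1))" by simp
  moreover have "((\<lambda>t. x + t *\<^sub>R axis i 1) has_derivative (\<lambda>t. t *\<^sub>R axis i 1)) (at 0)"
    by (auto intro!: derivative_eq_intros)
  ultimately have "((\<lambda>t. f (x + t *\<^sub>R axis i 1)) has_derivative
      (\<lambda>t. frechet_derivative f (at x) (t *\<^sub>R axis i 1))) (at 0)"
    by (rule has_derivative_compose[rotated])
  moreover have "linear (frechet_derivative f (at x))"
    using assms linear_frechet_derivative by blast
  then have "(\<lambda>t. frechet_derivative f (at x) (t *\<^sub>R axis i 1)) = (*) (partial i f x)"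
    by (auto simp: fun_eq_iff linear_scale partial_def)
  ultimately show ?thesis
    unfolding has_partial_def has_field_derivative_def by simp
qed

lemma has_partial_unique: "has_partial i f d x \<Longrightarrow> has_partial i f d' x \<Longrightarrow> d = d'"
  unfolding has_partial_def by (rule DERIV_unique)

text \<open>The bridge between two notions: \<open>partial\<close> is read off a Frechet derivative,
  whereas \<open>has_partial\<close> is a one-variable derivative along a coordinate line and
  inherits its product and chain rules from real calculus.\<close>

lemma partial_eqI: "f differentiable (at x) \<Longrightarrow> has_partial i f d x \<Longrightarrow> partial i f x = d"
  using has_partial_partial has_partial_unique by blast

lemma has_partial_const: "has_partial i (\<lambda>_. c) 0 x"
  unfolding has_partial_def by simp

lemma has_partial_mult:
  "has_partial i f a x \<Longrightarrow> has_partial i g b x \<Longrightarrow> has_partial i (\<lambda>x. f x * g x) (a * g x + f x * b) x"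
  unfolding has_partial_def by (auto intro!: derivative_eq_intros)

lemma has_partial_add:
  "has_partial i f a x \<Longrightarrow> has_partial i g b x \<Longrightarrow> has_partial i (\<lambda>x. f x + g x) (a + b) x"
  unfolding has_partial_def by (auto intro!: derivative_eq_intros)

lemma has_partial_diff:
  "has_partial i f a x \<Longrightarrow> has_partial i g b x \<Longrightarrow> has_partial i (\<lambda>x. f x - g x) (a - b) x"
  unfolding has_partial_def by (auto intro!: derivative_eq_intros)

lemma has_partial_chain:
  "has_partial i f a x \<Longrightarrow> (\<phi> has_real_derivative b) (at (f x)) \<Longrightarrow> has_partial i (\<lambda>x. \<phi> (f x)) (b * a) x"
  unfolding has_partial_def using DERIV_chain'[of "\<lambda>t. f (x + t *\<^sub>R axis i 1)" a 0 UNIV \<phi> b]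
  by (simp add: mult.commute)

lemma has_partial_cong:
  assumes "open U" "x \<in> U" "\<And>y. y \<in> U \<Longrightarrow> f y = g y" "has_partial i f d x"
  shows "has_partial i g d x"
proof -
  have "((\<lambda>t. x + t *\<^sub>R axis i (1::real)) \<longlongrightarrow> x + 0 *\<^sub>R axis i 1) (at 0)"
    by (intro tendsto_intros)
  then have "eventually (\<lambda>t. x + t *\<^sub>R axis i (1::real) \<in> U) (at 0)"
    using assms(1,2) by (auto dest: topological_tendstoD)
  then have "eventually (\<lambda>t. x + t *\<^sub>R axis i (1::real) \<in> U) (nhds 0)"
    unfolding eventually_at_filter by (rule eventually_mono) (use assms(2) in auto)
  then have "eventually (\<lambda>t. f (x + t *\<^sub>R axis i 1) = g (x + t *\<^sub>R axis i 1)) (nhds 0)"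
    by (rule eventually_mono) (use assms(3) in auto)
  then show ?thesis using assms(4) unfolding has_partial_def
    by (subst (asm) DERIV_cong_ev[OF refl _ refl])
qed

section \<open>Vanishing of the integral of a compactly supported derivative\<close>

lemma integral_translation:
  fixes h :: "'a::euclidean_space \<Rightarrow> real"
  assumes "h \<in> borel_measurable borel"
  shows "(\<integral>x. h (x + c) \<partial>lborel) = (\<integral>x. h x \<partial>lborel)"
proof -
  have "(\<integral>x. h x \<partial>lborel) = (\<integral>x. h x \<partial>(distr lborel borel ((+) c)))"
    by (simp add: lborel_distr_plus)
  also have "\<dots> = (\<integral>x. h (c + x) \<partial>lborel)"
    by (subst integral_distr) (use assms in auto)
  finally show ?thesis by (simp add: add.commute)
qed

lemma integrable_bounded_support:
  fixes h :: "'a::euclidean_space \<Rightarrow> real"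
  assumes "h \<in> borel_measurable borel" "\<And>x. \<bar>h x\<bar> \<le> B" "\<And>x. x \<notin> ball c R \<Longrightarrow> h x = 0"
  shows "integrable lborel h"
proof (rule Bochner_Integration.integrable_bound)
  show "integrable lborel (\<lambda>x. B * indicator (ball c R) x :: real)"
    by (intro integrable_mult_right integrable_real_indicator emeasure_lborel_ball_finite) simp
  have "B \<ge> 0" using assms(2)[of c] by linarith
  then show "AE x in lborel. norm (h x) \<le> norm (B * indicator (ball c R) x :: real)"
    using assms(2,3) by (intro always_eventually) (auto simp: indicator_def)
qed (use assms in auto)

text \<open>The integral of the difference quotients vanishes by translation invariance.\<close>

lemma integral_partial_eq_0:
  fixes h h' :: "real^2 \<Rightarrow> real"
  assumes deriv: "\<And>x. has_partial i h (h' x) x" and cont: "continuous_on UNIV h" "continuous_on UNIV h'"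
    and supp: "\<And>x. x \<notin> ball c R \<Longrightarrow> h x = 0" "\<And>x. x \<notin> ball c R \<Longrightarrow> h' x = 0"
  shows "integrable lborel h'" "(\<integral>x. h' x \<partial>lborel) = 0"
proof -
  let ?e = "axis i 1 :: real^2"
  have bdd: "\<exists>B. \<forall>x. \<bar>k x\<bar> \<le> B" if "continuous_on UNIV k" "\<And>x. x \<notin> ball c R \<Longrightarrow> k x = 0"
    for k :: "real^2 \<Rightarrow> real"
  proof -
    have "compact (k ` cball c R)"
      by (intro compact_continuous_image continuous_on_subset[OF that(1)]) auto
    then obtain B where B: "B > 0" "\<And>x. x \<in> cball c R \<Longrightarrow> \<bar>k x\<bar> \<le> B"
      using compact_imp_bounded[of "k ` cball c R"] by (auto simp: bounded_pos)
    have "\<bar>k x\<bar> \<le> B" for x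
      using B that(2)[of x] by (cases "x \<in> ball c R") auto
    then show ?thesis by blast
  qed
  obtain B where B: "\<And>x. \<bar>h' x\<bar> \<le> B" using bdd[OF cont(2) supp(2)] by blast
  obtain B0 where B0: "\<And>x. \<bar>h x\<bar> \<le> B0" using bdd[OF cont(1) supp(1)] by blast
  have meas: "h \<in> borel_measurable borel" "h' \<in> borel_measurable borel"
    using cont by (auto intro: borel_measurable_continuous_onI)
  have int: "integrable lborel h" by (rule integrable_bounded_support[OF meas(1) B0 supp(1)])
  show "integrable lborel h'" by (rule integrable_bounded_support[OF meas(2) B supp(2)])
  define t where "t n = inverse (real (Suc n))" for n
  define D where "D n x = (h (x + t n *\<^sub>R ?e) - h x) / t n" for n x
  have t0: "t n > 0" "t n \<le> 1" for n by (auto simp: t_def field_simps)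
  have tlim: "t \<longlonglongrightarrow> 0" unfolding t_def by (rule LIMSEQ_inverse_real_of_nat)
  have [measurable]: "D n \<in> borel_measurable borel" for n
    unfolding D_def using meas by measurable
  have "(\<lambda>n. \<integral>x. D n x \<partial>lborel) \<longlonglongrightarrow> (\<integral>x. h' x \<partial>lborel)"
  \<comment> \<open>By the mean value theorem each quotient is a value of \<open>h'\<close>; as
    \<open>t n \<le> 1\<close>, it vanishes outside the ball of radius \<open>R + 1\<close>.\<close>
  proof (rule integral_dominated_convergence[where w = "\<lambda>x. B * indicator (ball c (R + 1)) x"])
    show "integrable lborel (\<lambda>x. B * indicator (ball c (R + 1)) x :: real)"
      by (intro integrable_mult_right integrable_real_indicator emeasure_lborel_ball_finite) simp
    have "(\<lambda>n. D n x) \<longlonglongrightarrow> h' x" for x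
    proof -
      have "((\<lambda>s. (h (x + s *\<^sub>R ?e) - h x) / s) \<longlongrightarrow> h' x) (at 0)"
        using deriv[of x] unfolding has_partial_def has_field_derivative_iff by simp
      moreover have "filterlim t (at 0) sequentially"
        using tlim t0(1) unfolding filterlim_at by (auto simp: less_imp_neq[symmetric])
      ultimately show ?thesis unfolding D_def by (rule filterlim_compose)
    qed
    then show "AE x in lborel. (\<lambda>n. D n x) \<longlonglongrightarrow> h' x" by simp
    have "\<bar>D n x\<bar> \<le> B * indicator (ball c (R + 1)) x" for n x
    proof (cases "x \<in> ball c (R + 1)")
      case True
      obtain z where "z > 0" "z < t n" "h (x + t n *\<^sub>R ?e) - h (x + 0 *\<^sub>R ?e) = (t n - 0) * h' (x + z *\<^sub>R ?e)"
        using MVT2[of 0 "t n" "\<lambda>s. h (x + s *\<^sub>R ?e)" "\<lambda>s. h' (x + s *\<^sub>R ?e)"] t0(1)[of n]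
          has_partial_line[OF deriv] by blast
      then have "D n x = h' (x + z *\<^sub>R ?e)" using t0(1)[of n] by (simp add: D_def)
      then show ?thesis using B True by simp
    next
      case False
      have "dist c x \<le> dist c (x + t n *\<^sub>R ?e) + dist (x + t n *\<^sub>R ?e) x" by (rule dist_triangle)
      also have "dist (x + t n *\<^sub>R ?e) x \<le> 1" using t0[of n] by (simp add: dist_norm)
      finally have "x + t n *\<^sub>R ?e \<notin> ball c R" "x \<notin> ball c R" using False by auto
      then show ?thesis using False supp(1) by (simp add: D_def)
    qed
    then show "AE x in lborel. norm (D n x) \<le> B * indicator (ball c (R + 1)) x" for n by simp
  qed (use meas in auto)
  moreover have "(\<integral>x. D n x \<partial>lborel) = 0" for n
  proof -
    have "integrable lborel (\<lambda>x. h (x + t n *\<^sub>R ?e))"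
    proof (rule integrable_bounded_support[of _ B0 "c - t n *\<^sub>R ?e" R])
      show "h (x + t n *\<^sub>R ?e) = 0" if "x \<notin> ball (c - t n *\<^sub>R ?e) R" for x
        using that by (intro supp(1)) (simp add: dist_norm algebra_simps)
    qed (use meas B0 in auto)
    then show ?thesis unfolding D_def using int integral_translation[OF meas(1), of "t n *\<^sub>R ?e"]
      by (simp add: Bochner_Integration.integral_diff)
  qed
  ultimately show "(\<integral>x. h' x \<partial>lborel) = 0" by (simp add: LIMSEQ_const_iff)
qed

section \<open>The logarithmic test function\<close>

text \<open>Dyadic rings replace polar coordinates. On the ring between radii r/2^(n+1) and r/2^n
  the kernel is at most 2^(n+1)/r, which is the value of \<open>s n\<close>; the whole disc of
  radius r/2^n then contributes 2 pi r/2^n, and the geometric series gives 4 pi r, twice the exact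
  value.\<close>

lemma integral_inverse_norm_ball:
  fixes c :: "real^2"
  assumes "r > 0"
  shows "integrable lborel (\<lambda>x. indicator (ball c r) x / norm (x - c) :: real)" (is "integrable lborel ?k")
    and "(\<integral>x. indicator (ball c r) x / norm (x - c) \<partial>lborel) \<le> 4 * pi * r"
proof -
  define s where "s n x = 2 ^ Suc n / r * indicator (ball c (r / 2 ^ n)) x" for n :: nat and x
  have dyadic: "ennreal (?k x) \<le> (\<Sum>n. ennreal (s n x))" for x
  proof (cases "x \<in> ball c r \<and> x \<noteq> c")
    case True
    define y where "y = norm (x - c)"
    have y: "0 < y" "y < r" using True by (auto simp: y_def dist_norm norm_minus_commute)
    have "\<exists>n. r / 2 ^ n \<le> y"
    proof -
      obtain n where "(1/2) ^ n < y / r"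
        using real_arch_pow_inv[of "y / r" "1/2"] y by auto
      then show ?thesis using y assms by (intro exI[of _ n]) (auto simp: field_simps power_divide)
    qed
    then obtain m where m: "r / 2 ^ m \<le> y" "\<And>n. n < m \<Longrightarrow> y < r / 2 ^ n"
      using exists_least_iff[of "\<lambda>n. r / 2 ^ n \<le> y"] not_less by metis
    \<comment> \<open>\<open>m = 0\<close> is excluded by \<open>y < r\<close>, so the predecessor
      \<open>n\<close> exists and indexes the ring containing \<open>x\<close>.\<close>
    with y obtain n where n: "m = Suc n" by (cases m) auto
    have "1 / y \<le> 2 ^ Suc n / r"
      using m(1) y assms unfolding n by (simp add: field_simps)
    moreover have "x \<in> ball c (r / 2 ^ n)"
      using m(2)[of n] n by (auto simp: y_def dist_norm norm_minus_commute)
    ultimately have "?k x \<le> s n x" using True by (simp add: s_def y_def)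
    then have "ennreal (?k x) \<le> ennreal (s n x)" by (rule ennreal_leI)
    also have "\<dots> = (\<Sum>i\<in>{n}. ennreal (s i x))" by simp
    also have "\<dots> \<le> (\<Sum>n. ennreal (s n x))" by (intro sum_le_suminf) auto
    finally show ?thesis .
  \<comment> \<open>At the centre the kernel is 0 because division by zero gives 0; outside the ball
    the indicator vanishes.\<close>
  qed (auto simp: indicator_def)
  have "(\<integral>\<^sup>+x. ennreal (?k x) \<partial>lborel) \<le> (\<integral>\<^sup>+x. (\<Sum>n. ennreal (s n x)) \<partial>lborel)"
    by (intro nn_integral_mono dyadic)
  also have "\<dots> = (\<Sum>n. \<integral>\<^sup>+x. ennreal (s n x) \<partial>lborel)"
    unfolding s_def by (intro nn_integral_suminf measurable_compose[OF _ measurable_ennreal]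
        borel_measurable_times borel_measurable_indicator) auto
  also have "\<dots> = (\<Sum>n. ennreal (2 * pi * r * (1/2) ^ n))"
  proof (intro suminf_cong)
    fix n :: nat
    have "(\<integral>\<^sup>+x. ennreal (s n x) \<partial>lborel)
        = (\<integral>\<^sup>+x. ennreal (2 ^ Suc n / r) * indicator (ball c (r / 2 ^ n)) x \<partial>lborel)"
      by (intro nn_integral_cong) (auto simp: s_def indicator_def)
    also have "\<dots> = ennreal (2 ^ Suc n / r) * ennreal (unit_ball_vol 2 * (r / 2 ^ n) ^ 2)"
      using assms by (subst nn_integral_cmult_indicator) (auto simp: emeasure_ball)
    also have "\<dots> = ennreal (2 ^ Suc n / r * (pi * (r / 2 ^ n) ^ 2))"
      using assms by (subst ennreal_mult[symmetric]) (auto simp: unit_ball_vol_2)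
    also have "2 ^ Suc n / r * (pi * (r / 2 ^ n) ^ 2) = 2 * pi * r * (1/2) ^ n"
      using assms by (simp add: field_simps power2_eq_square)
    finally show "(\<integral>\<^sup>+x. ennreal (s n x) \<partial>lborel) = ennreal (2 * pi * r * (1/2) ^ n)" .
  qed
  also have "\<dots> = ennreal (4 * pi * r)"
  proof (rule suminf_ennreal_eq)
    show "(\<lambda>n. 2 * pi * r * (1/2) ^ n) sums (4 * pi * r)"
      using sums_mult[OF geometric_sums[of "1/2::real"], of "2 * pi * r"] by (simp add: mult_ac)
  qed (use assms in auto)
  finally have le: "(\<integral>\<^sup>+x. ennreal (?k x) \<partial>lborel) \<le> ennreal (4 * pi * r)" .
  show int: "integrable lborel ?k"
  proof (rule integrableI_nonneg)
    show "(\<integral>\<^sup>+x. ennreal (?k x) \<partial>lborel) < \<infinity>" using le by (auto simp: less_top[symmetric] top_unique)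
  qed (auto intro!: borel_measurable_divide borel_measurable_indicator)
  have "ennreal (\<integral>x. ?k x \<partial>lborel) \<le> ennreal (4 * pi * r)"
    using le by (subst nn_integral_eq_integral[symmetric]) (auto simp: int)
  then show "(\<integral>x. ?k x \<partial>lborel) \<le> 4 * pi * r" using assms by (subst (asm) ennreal_le_iff) auto
qed

text \<open>A logarithm, up to sign the fundamental solution of the planar Laplacian in the variable
  \<open>\<bar>y\<bar>\<^sup>2\<close>, corrected by its Taylor polynomial at \<open>1\<close> so that the extension by \<open>0\<close> is \<open>C\<^sup>2\<close>.\<close>

definition cutlog :: "real \<Rightarrow> real" where
  "cutlog t = (if t < 1 then - ln t + (t - 1) - (t - 1)\<^sup>2 / 2 else 0)"

definition cutlog' :: "real \<Rightarrow> real" where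
  "cutlog' t = (if t < 1 then - (1 - t)\<^sup>2 / t else 0)"

definition cutlog'' :: "real \<Rightarrow> real" where
  "cutlog'' t = (if t < 1 then 1 / t\<^sup>2 - 1 else 0)"

text \<open>At the junction \<open>t = 1\<close> the difference quotient of the truncated function
  is dominated by that of \<open>\<phi>\<close>, which tends to
  \<open>\<phi>' 1 = 0\<close>.\<close>

lemma DERIV_zero_beyond_1:
  fixes \<phi> :: "real \<Rightarrow> real"
  assumes "\<And>t. 0 < t \<Longrightarrow> (\<phi> has_real_derivative \<phi>' t) (at t)" "\<phi> 1 = 0" "\<phi>' 1 = 0" "0 < t"
  shows "((\<lambda>t. if t < 1 then \<phi> t else 0) has_real_derivative (if t < 1 then \<phi>' t else 0)) (at t)"
proof -
  consider "t < 1" | "t > 1" | "t = 1" by linarith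
  then show ?thesis
  proof cases
    case 1
    have "eventually (\<lambda>s. \<phi> s = (if s < 1 then \<phi> s else 0)) (nhds t)"
      by (rule eventually_mono[OF eventually_nhds_in_open[of "{..<1}"]]) (use 1 in auto)
    then show ?thesis using assms(1)[OF assms(4)] 1
      by (subst (asm) DERIV_cong_ev[OF refl _ refl]) auto
  next
    case 2
    have "eventually (\<lambda>s. 0 = (if s < 1 then \<phi> s else 0)) (nhds t)"
      by (rule eventually_mono[OF eventually_nhds_in_open[of "{1<..}"]]) (use 2 in auto)
    then have "((\<lambda>s. 0) has_real_derivative 0) (at t) \<longleftrightarrow>
        ((\<lambda>s. if s < 1 then \<phi> s else 0) has_real_derivative 0) (at t)"
      by (rule DERIV_cong_ev[OF refl _ refl])
    then show ?thesis using 2 by simp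
  next
    case 3
    have "((\<lambda>s. (\<phi> s - \<phi> 1) / (s - 1)) \<longlongrightarrow> 0) (at 1)"
      using assms(1)[of 1] assms(3) by (simp add: has_field_derivative_iff)
    then have "((\<lambda>s. ((if s < 1 then \<phi> s else 0) - 0) / (s - 1)) \<longlongrightarrow> 0) (at 1)"
      by (rule Lim_null_comparison[rotated, OF tendsto_rabs_zero])
        (auto simp: assms(2) intro!: always_eventually)
    then show ?thesis using 3 by (simp add: has_field_derivative_iff)
  qed
qed

lemma DERIV_cutlog: "0 < t \<Longrightarrow> (cutlog has_real_derivative cutlog' t) (at t)"
  unfolding cutlog_def[abs_def] cutlog'_def
  by (rule DERIV_zero_beyond_1)
    (auto intro!: derivative_eq_intros simp: field_simps power2_eq_square)

lemma DERIV_cutlog': "0 < t \<Longrightarrow> (cutlog' has_real_derivative cutlog'' t) (at t)"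
  unfolding cutlog'_def[abs_def] cutlog''_def
  by (rule DERIV_zero_beyond_1)
    (auto intro!: derivative_eq_intros simp: field_simps power2_eq_square)

lemma continuous_on_cutlog'': "continuous_on {0<..} cutlog''"
proof -
  have eq: "cutlog'' = (\<lambda>t. 1 / (min t 1)\<^sup>2 - 1)" by (auto simp: cutlog''_def fun_eq_iff)
  show ?thesis unfolding eq by (auto intro!: continuous_intros)
qed

text \<open>The last identity is the radial Laplacian: in the plane the Laplacian of h(|y|^2) is 4
  (h' + t h'') at t = |y|^2. The logarithm contributes 0 and the Taylor correction the bounded
  remainder 2 - 2t.\<close>

lemma cutlog_bounds:
  assumes "0 < t" "t < 1"
  shows "0 \<le> cutlog t" "cutlog t \<le> 2 / sqrt t" "\<bar>cutlog' t\<bar> \<le> 1 / t" "\<bar>cutlog'' t\<bar> \<le> 1 / t\<^sup>2"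
    "cutlog' t + t * cutlog'' t = 2 - 2 * t"
proof -
  \<comment> \<open>Applying the logarithm bound to \<open>1 / sqrt t\<close> instead of
    \<open>1 / t\<close> gives one inverse power of the distance, which is integrable in the plane,
    rather than two.\<close>
  have "- ln t = 2 * ln (1 / sqrt t)" using assms by (simp add: ln_div ln_sqrt)
  also have "\<dots> \<le> 2 * (1 / sqrt t)" using ln_le_minus_one[of "1 / sqrt t"] assms by simp
  finally have "- ln t \<le> 2 / sqrt t" by simp
  moreover have "0 \<le> (t - 1)\<^sup>2 / 2" by simp
  ultimately show "cutlog t \<le> 2 / sqrt t" using assms
    unfolding cutlog_def by (simp only: if_True)
  show "0 \<le> cutlog t"
  proof (rule ccontr)
    assume "\<not> 0 \<le> cutlog t"
    moreover obtain z where "t < z" "z < 1" "cutlog 1 - cutlog t = (1 - t) * cutlog' z"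
      using MVT2[of t 1 cutlog cutlog'] DERIV_cutlog assms by force
    moreover have "cutlog 1 = 0" by (simp add: cutlog_def)
    moreover have "cutlog' z \<le> 0" if "t < z" "z < 1" using that assms by (simp add: cutlog'_def)
    ultimately show False using assms mult_nonneg_nonpos[of "1 - t" "cutlog' z"] by simp
  qed
  show "\<bar>cutlog' t\<bar> \<le> 1 / t" using assms
    by (simp add: cutlog'_def divide_right_mono power_le_one)
  show "\<bar>cutlog'' t\<bar> \<le> 1 / t\<^sup>2"
    using assms power_le_one[of t 2] by (simp add: cutlog''_def abs_if)
  show "cutlog' t + t * cutlog'' t = 2 - 2 * t"
    using assms by (simp add: cutlog'_def cutlog''_def field_simps power2_eq_square)
qed

section \<open>The test function for frozen coefficients\<close>

lemma has_partial_quotient_const: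
  "has_partial i f a x \<Longrightarrow> has_partial i (\<lambda>x. f x / k) (a / k) x"
  using has_partial_mult[OF _ has_partial_const[of i "1 / k"], of f a] by simp

lemma component_le_norm2: "\<bar>y $ 1\<bar> \<le> norm y" "\<bar>y $ 2\<bar> \<le> norm (y :: real^2)"
  by (rule component_le_norm_cart)+

lemma norm_2_sq: "(norm (y :: real^2))\<^sup>2 = (y $ 1)\<^sup>2 + (y $ 2)\<^sup>2"
  by (simp add: norm_vec_def L2_set_def sum_2)

text \<open>\<open>a0\<close>, \<open>b0\<close>, \<open>c0\<close> are the entries of the symmetric
  coefficient matrix frozen at the pole \<open>x0\<close>, \<open>S\<close> is the level of
  \<open>q\<close> at which the test function is cut off, and \<open>\<epsilon>\<close> smooths the
  pole.\<close>

locale test_function =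
  fixes x0 :: "real^2" and a0 b0 c0 B S \<epsilon> :: real
  assumes B: "1 \<le> B" "\<bar>a0\<bar> \<le> B" "\<bar>b0\<bar> \<le> B" "\<bar>c0\<bar> \<le> B"
    and det: "a0 * c0 - b0\<^sup>2 = 1" and pos: "0 < a0" and S: "0 < S" and \<epsilon>: "0 < \<epsilon>" "\<epsilon> \<le> S"
begin

definition q :: "real^2 \<Rightarrow> real" where
  "q x = c0 * (x$1 - x0$1)\<^sup>2 - 2 * b0 * (x$1 - x0$1) * (x$2 - x0$2) + a0 * (x$2 - x0$2)\<^sup>2"

definition l1 :: "real^2 \<Rightarrow> real" where "l1 x = c0 * (x$1 - x0$1) - b0 * (x$2 - x0$2)"
definition l2 :: "real^2 \<Rightarrow> real" where "l2 x = a0 * (x$2 - x0$2) - b0 * (x$1 - x0$1)"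

text \<open>This normalisation makes \<open>t x < 1\<close> equivalent to \<open>q x < S\<close>, so
  the support of the test function does not move with \<open>\<epsilon>\<close>.\<close>

definition T where "T = S + \<epsilon>"
definition t where "t x = (q x + \<epsilon>) / T"

definition \<Phi> where "\<Phi> x = cutlog (t x)"
definition \<Phi>1 where "\<Phi>1 x = cutlog' (t x) * (2 * l1 x / T)"
definition \<Phi>2 where "\<Phi>2 x = cutlog' (t x) * (2 * l2 x / T)"
definition \<Phi>11 where "\<Phi>11 x = cutlog'' (t x) * (2 * l1 x / T)\<^sup>2 + cutlog' (t x) * (2 * c0 / T)"
definition \<Phi>12 where
  "\<Phi>12 x = cutlog'' (t x) * (2 * l1 x / T) * (2 * l2 x / T) - cutlog' (t x) * (2 * b0 / T)"
definition \<Phi>22 where "\<Phi>22 x = cutlog'' (t x) * (2 * l2 x / T)\<^sup>2 + cutlog' (t x) * (2 * a0 / T)"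

lemma T: "T > 0" "S \<le> T" "\<epsilon> \<le> T" "T \<le> 2 * S" using S \<epsilon> by (auto simp: T_def)

lemma c0: "0 < c0"
proof -
  have "0 < a0 * c0" using det zero_le_power2[of b0] by linarith
  then show ?thesis using pos by (simp add: zero_less_mult_iff)
qed

text \<open>Cayley-Hamilton: for the symmetric matrix Q of the form \<open>q\<close>, tr(Q) Q -
  det(Q) I = Q^2 is nonnegative. Here det(Q) = 1 and tr(Q) = \<open>a0 + c0\<close> is at most
  \<open>2 * B\<close>; the vector (\<open>l1\<close>, \<open>l2\<close>) is Q (x - x0).\<close>

lemma q_lower: "(norm (x - x0))\<^sup>2 \<le> 2 * B * q x"
proof -
  let ?u = "x$1 - x0$1" and ?v = "x$2 - x0$2"
  have "(a0 + c0) * q x - (a0 * c0 - b0\<^sup>2) * (?u\<^sup>2 + ?v\<^sup>2) = (l1 x)\<^sup>2 + (l2 x)\<^sup>2"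
    by (simp add: q_def l1_def l2_def power2_eq_square algebra_simps)
  then have "(a0 + c0) * q x = ?u\<^sup>2 + ?v\<^sup>2 + ((l1 x)\<^sup>2 + (l2 x)\<^sup>2)" unfolding det by simp
  then have le: "?u\<^sup>2 + ?v\<^sup>2 \<le> (a0 + c0) * q x" by simp
  moreover have "0 \<le> ?u\<^sup>2 + ?v\<^sup>2" by simp
  ultimately have "0 \<le> (a0 + c0) * q x" by (rule order_trans[rotated])
  then have "0 \<le> q x" using pos c0 by (simp add: zero_le_mult_iff)
  then have "(a0 + c0) * q x \<le> 2 * B * q x" using B by (intro mult_right_mono) auto
  with le show ?thesis by (simp add: norm_2_sq)
qed

lemma q_nonneg: "0 \<le> q x"
proof -
  have "0 \<le> 2 * B * q x" using order_trans[OF zero_le_power2 q_lower] .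
  then show ?thesis using B by (simp add: zero_le_mult_iff)
qed

lemma l_bound: "\<bar>l1 x\<bar> \<le> 2 * B * norm (x - x0)" "\<bar>l2 x\<bar> \<le> 2 * B * norm (x - x0)"
proof -
  let ?n = "norm (x - x0)"
  have *: "\<bar>k * (x$i - x0$i)\<bar> \<le> B * ?n" if "\<bar>k\<bar> \<le> B" for k i
    using that component_le_norm_cart[of "x - x0" i] B by (auto simp: abs_mult intro!: mult_mono)
  show "\<bar>l1 x\<bar> \<le> 2 * B * ?n" "\<bar>l2 x\<bar> \<le> 2 * B * ?n"
    unfolding l1_def l2_def
    using *[OF B(2), of 2] *[OF B(3), of 1] *[OF B(3), of 2] *[OF B(4), of 1]
    by linarith+
qed

lemma q_upper: "q x \<le> 4 * B * (norm (x - x0))\<^sup>2"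
proof -
  let ?n = "norm (x - x0)"
  have "q x = (x$1 - x0$1) * l1 x + (x$2 - x0$2) * l2 x"
    by (simp add: q_def l1_def l2_def power2_eq_square algebra_simps)
  also have "\<dots> \<le> \<bar>x$1 - x0$1\<bar> * \<bar>l1 x\<bar> + \<bar>x$2 - x0$2\<bar> * \<bar>l2 x\<bar>"
    by (intro add_mono) (simp_all flip: abs_mult)
  also have "\<dots> \<le> ?n * (2 * B * ?n) + ?n * (2 * B * ?n)"
    using l_bound[of x] component_le_norm_cart[of "x - x0" 1] component_le_norm_cart[of "x - x0" 2]
    by (intro add_mono mult_mono) auto
  finally show ?thesis by (simp add: power2_eq_square algebra_simps)
qed

lemma t_pos: "0 < t x"
  using q_nonneg[of x] \<epsilon> T by (simp add: t_def)

lemma t_less_1_iff: "t x < 1 \<longleftrightarrow> q x < S"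
  using T by (simp add: t_def T_def field_simps)

lemma has_partial_q: "has_partial 1 q (2 * l1 x) x" "has_partial 2 q (2 * l2 x) x"
  unfolding has_partial_def q_def l1_def l2_def
  by (auto simp: axis_def algebra_simps intro!: derivative_eq_intros)

lemma has_partial_l: "has_partial 1 l1 c0 x" "has_partial 2 l1 (- b0) x"
    "has_partial 1 l2 (- b0) x" "has_partial 2 l2 a0 x"
  unfolding has_partial_def l1_def l2_def
  by (auto simp: axis_def intro!: derivative_eq_intros)

lemma has_partial_t: "has_partial 1 t (2 * l1 x / T) x" "has_partial 2 t (2 * l2 x / T) x"
  using has_partial_quotient_const[OF has_partial_add[OF has_partial_q(1) has_partial_const[of _ \<epsilon>]]]
    has_partial_quotient_const[OF has_partial_add[OF has_partial_q(2) has_partial_const[of _ \<epsilon>]]]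
  by (auto simp: t_def[abs_def])

lemma has_partial_\<Phi>: "has_partial 1 \<Phi> (\<Phi>1 x) x" "has_partial 2 \<Phi> (\<Phi>2 x) x"
  unfolding \<Phi>_def[abs_def] \<Phi>1_def \<Phi>2_def
  by (intro has_partial_chain has_partial_t DERIV_cutlog t_pos)+

lemma has_partial_\<Phi>':
  "has_partial 1 \<Phi>1 (\<Phi>11 x) x" "has_partial 2 \<Phi>1 (\<Phi>12 x) x"
  "has_partial 1 \<Phi>2 (\<Phi>12 x) x" "has_partial 2 \<Phi>2 (\<Phi>22 x) x"
proof -
  have scale: "has_partial i (\<lambda>x. 2 * l x / T) (2 * d / T) x" if "has_partial i l d x" for i l d
    using has_partial_mult[OF has_partial_const[of i "2 / T"] that] by simp
  have *: "has_partial i (\<lambda>x. cutlog' (t x) * (2 * l x / T))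
      (cutlog'' (t x) * e * (2 * l x / T) + cutlog' (t x) * (2 * d / T)) x"
    if "has_partial i t e x" "has_partial i l d x" for i l d e
    by (intro has_partial_mult has_partial_chain that scale DERIV_cutlog' t_pos)
  show "has_partial 1 \<Phi>1 (\<Phi>11 x) x"
    unfolding \<Phi>1_def[abs_def] \<Phi>11_def power2_eq_square
    using *[OF has_partial_t(1) has_partial_l(1)] by (simp only: mult.assoc)
  show "has_partial 2 \<Phi>1 (\<Phi>12 x) x"
    unfolding \<Phi>1_def[abs_def] \<Phi>12_def
    using *[OF has_partial_t(2) has_partial_l(2)] by (simp add: mult_ac)
  show "has_partial 1 \<Phi>2 (\<Phi>12 x) x"
    unfolding \<Phi>2_def[abs_def] \<Phi>12_def
    using *[OF has_partial_t(1) has_partial_l(3)] by (simp add: mult_ac)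
  show "has_partial 2 \<Phi>2 (\<Phi>22 x) x"
    unfolding \<Phi>2_def[abs_def] \<Phi>22_def power2_eq_square
    using *[OF has_partial_t(2) has_partial_l(4)] by (simp only: mult.assoc)
qed

lemma continuous_test_function:
  "continuous_on A q" "continuous_on A \<Phi>" "continuous_on A \<Phi>1" "continuous_on A \<Phi>2" "continuous_on A \<Phi>11"
  "continuous_on A \<Phi>12" "continuous_on A \<Phi>22"
proof -
  show q: "continuous_on A q" unfolding q_def[abs_def] by (intro continuous_intros)
  have l: "continuous_on A l1" "continuous_on A l2"
    unfolding l1_def[abs_def] l2_def[abs_def] by (intro continuous_intros)+
  have t: "continuous_on A t" unfolding t_def[abs_def] using T by (intro continuous_intros q) auto
  have *: "continuous_on A (\<lambda>x. \<phi> (t x))" if "continuous_on {0<..} \<phi>" for \<phi> :: "real \<Rightarrow> real"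
    by (rule continuous_on_compose2[OF that t]) (use t_pos in auto)
  have "continuous_on {0<..} cutlog" "continuous_on {0<..} cutlog'"
    using DERIV_cutlog DERIV_cutlog' DERIV_isCont
    by (auto intro!: continuous_at_imp_continuous_on) blast+
  note c = this[THEN *] *[OF continuous_on_cutlog'']
  show "continuous_on A \<Phi>" "continuous_on A \<Phi>1" "continuous_on A \<Phi>2" "continuous_on A \<Phi>11"
    "continuous_on A \<Phi>12" "continuous_on A \<Phi>22"
    unfolding \<Phi>_def[abs_def] \<Phi>1_def[abs_def] \<Phi>2_def[abs_def] \<Phi>11_def[abs_def] \<Phi>12_def[abs_def]
      \<Phi>22_def[abs_def]
    using T by (auto intro!: continuous_intros c l)
qed

lemma test_function_eq_0:
  assumes "S \<le> q x"
  shows "\<Phi> x = 0" "\<Phi>1 x = 0" "\<Phi>2 x = 0" "\<Phi>11 x = 0" "\<Phi>12 x = 0" "\<Phi>22 x = 0"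
  using assms t_less_1_iff[of x]
  by (auto simp: \<Phi>_def \<Phi>1_def \<Phi>2_def \<Phi>11_def \<Phi>12_def \<Phi>22_def cutlog_def cutlog'_def cutlog''_def)

text \<open>All bounds are uniform in \<open>\<epsilon>\<close>: it enters through
  \<open>T * t x = q x + \<epsilon>\<close>, which is at least |x - x0|^2 / (2B), and through
  \<open>T \<le> 2 * S\<close>. The constant 68 is 64 from the term with \<open>cutlog''\<close>
  plus 4 from the term with \<open>cutlog'\<close>.\<close>

lemma
  assumes "q x < S" "x \<noteq> x0"
  shows \<Phi>_nonneg: "0 \<le> \<Phi> x"
    and \<Phi>_le: "\<Phi> x \<le> 4 * sqrt (B * S) / norm (x - x0)"
    and \<Phi>1_le: "\<bar>\<Phi>1 x\<bar> \<le> 8 * B\<^sup>2 / norm (x - x0)"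
    and \<Phi>2_le: "\<bar>\<Phi>2 x\<bar> \<le> 8 * B\<^sup>2 / norm (x - x0)"
    and \<Phi>11_le: "\<bar>\<Phi>11 x\<bar> \<le> 68 * B^4 / (norm (x - x0))\<^sup>2"
    and \<Phi>12_le: "\<bar>\<Phi>12 x\<bar> \<le> 68 * B^4 / (norm (x - x0))\<^sup>2"
    and \<Phi>22_le: "\<bar>\<Phi>22 x\<bar> \<le> 68 * B^4 / (norm (x - x0))\<^sup>2"
proof -
  let ?n = "norm (x - x0)"
  have n: "?n > 0" using assms by simp
  have t: "0 < t x" "t x < 1" using t_pos t_less_1_iff assms by auto
  note cb = cutlog_bounds[OF t]
  show "0 \<le> \<Phi> x" using cb by (simp add: \<Phi>_def)
  have Tt: "T * t x = q x + \<epsilon>" using T by (simp add: t_def)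
  have n2: "?n\<^sup>2 \<le> 2 * B * (T * t x)"
    unfolding Tt using B \<epsilon> by (intro order_trans[OF q_lower] mult_left_mono) auto
  have "?n \<le> sqrt (2 * B * (T * t x))" using n2 by (intro real_le_rsqrt)
  also have "\<dots> \<le> sqrt (2 * B * (2 * S * t x))"
    using B T t S by (intro real_sqrt_le_mono mult_left_mono mult_right_mono) auto
  also have "\<dots> = 2 * sqrt (B * S) * sqrt (t x)" by (simp add: real_sqrt_mult)
  finally have "2 / sqrt (t x) \<le> 4 * sqrt (B * S) / ?n" using t n by (simp add: field_simps)
  then show "\<Phi> x \<le> 4 * sqrt (B * S) / ?n" using cb by (simp add: \<Phi>_def)
  have p1: "\<bar>cutlog' (t x)\<bar> / T \<le> 2 * B / ?n\<^sup>2"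
  proof -
    have "\<bar>cutlog' (t x)\<bar> / T \<le> 1 / t x / T" using cb T by (intro divide_right_mono) auto
    also have "\<dots> \<le> 2 * B / ?n\<^sup>2" using n2 n t T by (simp add: field_simps)
    finally show ?thesis .
  qed
  have p2: "\<bar>cutlog'' (t x)\<bar> / T\<^sup>2 \<le> 4 * B\<^sup>2 / ?n^4"
  proof -
    have "\<bar>cutlog'' (t x)\<bar> / T\<^sup>2 \<le> 1 / (t x)\<^sup>2 / T\<^sup>2" using cb T by (intro divide_right_mono) auto
    also have "\<dots> = (1 / (T * t x))\<^sup>2" by (simp add: power_divide power_mult_distrib)
    also have "\<dots> \<le> (2 * B / ?n\<^sup>2)\<^sup>2" using n2 n t T by (intro power_mono) (auto simp: field_simps)
    finally show ?thesis by (simp add: power_divide power_mult_distrib)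
  qed
  have first: "\<bar>cutlog' (t x) * (2 * l / T)\<bar> \<le> 8 * B\<^sup>2 / ?n" if "\<bar>l\<bar> \<le> 2 * B * ?n" for l
  proof -
    have "\<bar>cutlog' (t x) * (2 * l / T)\<bar> = 2 * (\<bar>cutlog' (t x)\<bar> / T * \<bar>l\<bar>)"
      using T by (simp add: abs_mult)
    also have "\<dots> \<le> 2 * (2 * B / ?n\<^sup>2 * (2 * B * ?n))"
      using p1 that B T by (intro mult_left_mono mult_mono) auto
    also have "\<dots> = 8 * B\<^sup>2 / ?n" using n by (simp add: power2_eq_square field_simps)
    finally show ?thesis .
  qed
  then show "\<bar>\<Phi>1 x\<bar> \<le> 8 * B\<^sup>2 / ?n" "\<bar>\<Phi>2 x\<bar> \<le> 8 * B\<^sup>2 / ?n"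
    unfolding \<Phi>1_def \<Phi>2_def using l_bound by blast+
  have second: "\<bar>cutlog'' (t x) * (2 * l / T) * (2 * m / T) + cutlog' (t x) * (2 * k / T)\<bar>
      \<le> 68 * B^4 / ?n\<^sup>2" if "\<bar>l\<bar> \<le> 2 * B * ?n" "\<bar>m\<bar> \<le> 2 * B * ?n" "\<bar>k\<bar> \<le> B" for l m k
  proof -
    have "\<bar>cutlog'' (t x) * (2 * l / T) * (2 * m / T)\<bar> = 4 * (\<bar>cutlog'' (t x)\<bar> / T\<^sup>2 * (\<bar>l\<bar> * \<bar>m\<bar>))"
      using T by (simp add: abs_mult power2_eq_square)
    also have "\<dots> \<le> 4 * (4 * B\<^sup>2 / ?n^4 * ((2 * B * ?n) * (2 * B * ?n)))"
      using p2 that B T by (intro mult_left_mono mult_mono) auto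
    also have "\<dots> = 64 * B^4 / ?n\<^sup>2" using n by (simp add: power2_eq_square power4_eq_xxxx field_simps)
    finally have 1: "\<bar>cutlog'' (t x) * (2 * l / T) * (2 * m / T)\<bar> \<le> 64 * B^4 / ?n\<^sup>2" .
    have "\<bar>cutlog' (t x) * (2 * k / T)\<bar> = 2 * (\<bar>cutlog' (t x)\<bar> / T * \<bar>k\<bar>)"
      using T by (simp add: abs_mult)
    also have "\<dots> \<le> 2 * (2 * B / ?n\<^sup>2 * B)"
      using p1 that B T by (intro mult_left_mono mult_mono) auto
    also have "\<dots> = 4 * B\<^sup>2 / ?n\<^sup>2" by (simp add: power2_eq_square)
    also have "\<dots> \<le> 4 * B^4 / ?n\<^sup>2"
      using B by (intro divide_right_mono mult_left_mono power_increasing) auto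
    finally have 2: "\<bar>cutlog' (t x) * (2 * k / T)\<bar> \<le> 4 * B^4 / ?n\<^sup>2" .
    have eq: "64 * B^4 / ?n\<^sup>2 + 4 * B^4 / ?n\<^sup>2 = 68 * B^4 / ?n\<^sup>2" by (simp add: add_divide_distrib[symmetric])
    show ?thesis using order_trans[OF abs_triangle_ineq add_mono[OF 1 2]] by (simp only: eq)
  qed
  show "\<bar>\<Phi>11 x\<bar> \<le> 68 * B^4 / ?n\<^sup>2"
    using second[OF l_bound(1) l_bound(1) B(4)] by (simp add: \<Phi>11_def power2_eq_square mult.assoc)
  show "\<bar>\<Phi>22 x\<bar> \<le> 68 * B^4 / ?n\<^sup>2"
    using second[OF l_bound(2) l_bound(2) B(2)] by (simp add: \<Phi>22_def power2_eq_square mult.assoc)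
  show "\<bar>\<Phi>12 x\<bar> \<le> 68 * B^4 / ?n\<^sup>2"
    using second[OF l_bound(1) l_bound(2), of "- b0"] B(3) by (simp add: \<Phi>12_def)
qed

text \<open>The first term on the left is a multiple of an approximate identity at \<open>x0\<close> as \<open>\<epsilon>\<close> tends to \<open>0\<close>.\<close>

lemma frozen_operator:
  assumes "q x < S"
  shows "4 * \<epsilon> / (q x + \<epsilon>)\<^sup>2 - 12 / S \<le> - (a0 * \<Phi>11 x + 2 * b0 * \<Phi>12 x + c0 * \<Phi>22 x)"
proof -
  have t: "0 < t x" "t x < 1" using t_pos t_less_1_iff assms by auto
  have quad: "a0 * (l1 x)\<^sup>2 + 2 * b0 * (l1 x * l2 x) + c0 * (l2 x)\<^sup>2 = (a0 * c0 - b0\<^sup>2) * q x"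
    by (simp add: q_def l1_def l2_def power2_eq_square algebra_simps)
  have "a0 * \<Phi>11 x + 2 * b0 * \<Phi>12 x + c0 * \<Phi>22 x
    = 4 * cutlog'' (t x) / T\<^sup>2 * (a0 * (l1 x)\<^sup>2 + 2 * b0 * (l1 x * l2 x) + c0 * (l2 x)\<^sup>2)
      + 4 * cutlog' (t x) / T * (a0 * c0 - b0\<^sup>2)"
    using T by (simp add: \<Phi>11_def \<Phi>12_def \<Phi>22_def field_simps power2_eq_square)
  also have "\<dots> = 4 * cutlog'' (t x) / T\<^sup>2 * q x + 4 * cutlog' (t x) / T"
    by (simp add: quad det)
  \<comment> \<open>Without the shift by \<open>\<epsilon>\<close> this would be exactly the radial
    Laplacian, which is bounded; the shift leaves the extra term with \<open>cutlog''\<close>, which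
    concentrates at the pole.\<close>
  also have "q x = T * t x - \<epsilon>" using T by (simp add: t_def)
  also have "4 * cutlog'' (t x) / T\<^sup>2 * (T * t x - \<epsilon>) + 4 * cutlog' (t x) / T
      = 4 / T * (cutlog' (t x) + t x * cutlog'' (t x)) - 4 * \<epsilon> * (cutlog'' (t x) / T\<^sup>2)"
    using T by (simp add: field_simps power2_eq_square)
  also have "\<dots> = 8 / T * (1 - t x) - 4 * \<epsilon> * (cutlog'' (t x) / T\<^sup>2)"
    unfolding cutlog_bounds(5)[OF t] by (simp add: algebra_simps)
  also have "cutlog'' (t x) / T\<^sup>2 = 1 / (T * t x)\<^sup>2 - 1 / T\<^sup>2"
    using t T by (simp add: cutlog''_def diff_divide_distrib power_mult_distrib mult.commute)
  also have "T * t x = q x + \<epsilon>" using T by (simp add: t_def)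
  finally have eq: "a0 * \<Phi>11 x + 2 * b0 * \<Phi>12 x + c0 * \<Phi>22 x
    = 8 / T * (1 - t x) - 4 * \<epsilon> * (1 / (q x + \<epsilon>)\<^sup>2 - 1 / T\<^sup>2)" .
  have "8 / T * (1 - t x) \<le> 8 / S * 1"
    using t T S by (intro mult_mono divide_left_mono) auto
  moreover have "4 * \<epsilon> * (1 / T\<^sup>2) \<le> 4 / S"
  proof -
    have "4 * \<epsilon> * (1 / T\<^sup>2) \<le> 4 * T * (1 / T\<^sup>2)" using T by (intro mult_right_mono) auto
    also have "\<dots> = 4 / T" using T by (simp add: power2_eq_square)
    also have "\<dots> \<le> 4 / S" using T S by (intro divide_left_mono) auto
    finally show ?thesis .
  qed
  ultimately show ?thesis unfolding eq by (simp add: algebra_simps)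
qed

end

section \<open>A mean value inequality at a maximum\<close>

lemma continuous_on_UNIV_zero_outside:
  fixes f :: "'a::topological_space \<Rightarrow> real"
  assumes "continuous_on U f" "open U" "closed K" "K \<subseteq> U" "\<And>x. x \<notin> K \<Longrightarrow> f x = 0"
  shows "continuous_on UNIV f"
proof -
  have "continuous_on (- K) f"
    by (rule continuous_on_eq[of _ "\<lambda>_. 0"]) (use assms(5) in auto)
  then have "continuous_on (U \<union> - K) f"
    using assms by (intro continuous_on_open_Un) auto
  moreover have "U \<union> - K = UNIV" using assms(4) by auto
  ultimately show ?thesis by simp
qed

lemma frechet_derivative_eq_partials:
  assumes "f differentiable (at x)"
  shows "frechet_derivative f (at x) v = v $ 1 *\<^sub>R partial 1 f x + v $ 2 *\<^sub>R partial 2 f x"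
proof -
  interpret linear "frechet_derivative f (at x)" using assms by (rule linear_frechet_derivative)
  have "v = v $ 1 *\<^sub>R axis 1 1 + v $ 2 *\<^sub>R axis 2 1"
    by (auto simp: vec_eq_iff axis_def forall_2)
  then have "frechet_derivative f (at x) v
      = frechet_derivative f (at x) (v $ 1 *\<^sub>R axis 1 1 + v $ 2 *\<^sub>R axis 2 1)" by simp
  also have "\<dots> = v $ 1 *\<^sub>R partial 1 f x + v $ 2 *\<^sub>R partial 2 f x"
    by (simp add: add scale partial_def)
  finally show ?thesis .
qed

lemma partials_Lipschitz:
  fixes f :: "real^2 \<Rightarrow> real"
  assumes "convex A" "\<And>x. x \<in> A \<Longrightarrow> f differentiable (at x)" "\<And>x i. x \<in> A \<Longrightarrow> \<bar>partial i f x\<bar> \<le> B"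
    and "x \<in> A" "y \<in> A"
  shows "\<bar>f x - f y\<bar> \<le> 2 * B * norm (x - y)"
proof -
  have "norm (f x - f y) \<le> 2 * B * norm (x - y)"
  proof (rule differentiable_bound[OF assms(1)])
    fix z assume z: "z \<in> A"
    show "(f has_derivative frechet_derivative f (at z)) (at z within A)"
      using assms(2)[OF z] frechet_derivative_works has_derivative_at_withinI by blast
    show "onorm (frechet_derivative f (at z)) \<le> 2 * B"
    proof (rule onorm_le)
      fix v :: "real^2"
      have *: "\<bar>v $ 1 * partial 1 f z\<bar> \<le> norm v * B" "\<bar>v $ 2 * partial 2 f z\<bar> \<le> norm v * B"
        unfolding abs_mult using assms(3)[OF z] component_le_norm2[of v] by (auto intro!: mult_mono)
      show "norm (frechet_derivative f (at z) v) \<le> 2 * B * norm v"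
        unfolding frechet_derivative_eq_partials[OF assms(2)[OF z]]
        using order_trans[OF abs_triangle_ineq add_mono[OF *]] by (simp add: algebra_simps)
    qed
  qed (use assms in auto)
  then show ?thesis by simp
qed

text \<open>The divergence of the matrix (a b; b c) applied to the gradient of \<open>f\<close>.
  Divergence form is kept because Green's identity then holds exactly, with variable
  coefficients.\<close>

definition div_grad :: "(real^2 \<Rightarrow> real) \<Rightarrow> (real^2 \<Rightarrow> real) \<Rightarrow> (real^2 \<Rightarrow> real) \<Rightarrow>
    (real^2 \<Rightarrow> real) \<Rightarrow> real^2 \<Rightarrow> real" where
  "div_grad a b c f x = partial 1 (\<lambda>y. a y * partial 1 f y + b y * partial 2 f y) x
     + partial 2 (\<lambda>y. b y * partial 1 f y + c y * partial 2 f y) x"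

lemma Ck_on_1: "Ck_on 1 U f \<longleftrightarrow>
    (\<forall>x\<in>U. f differentiable (at x)) \<and> (\<forall>i. continuous_on U (partial i f))"
  by (simp add: One_nat_def)

lemma Ck_on_2: "Ck_on 2 U f \<longleftrightarrow> (\<forall>x\<in>U. f differentiable (at x)) \<and> (\<forall>i. Ck_on 1 U (partial i f))"
  by (simp add: numeral_2_eq_2)

lemma Ck_on_1_continuous: "Ck_on 1 U f \<Longrightarrow> continuous_on U f"
  by (auto simp: Ck_on_1 intro!: continuous_at_imp_continuous_on differentiable_imp_continuous_within)

lemma Ck_on_1_has_partial:
  "Ck_on 1 U f \<Longrightarrow> x \<in> U \<Longrightarrow> has_partial i f (partial i f x) x"
  by (simp add: Ck_on_1 has_partial_partial)

lemma div_grad_eq: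
  assumes C1: "Ck_on 1 U a" "Ck_on 1 U b" "Ck_on 1 U c" "Ck_on 2 U f" and x: "x \<in> U"
  shows "div_grad a b c f x =
    (partial 1 a x + partial 2 b x) * partial 1 f x + (partial 1 b x + partial 2 c x) * partial 2 f x
    + a x * partial 1 (partial 1 f) x + b x * partial 1 (partial 2 f) x
    + b x * partial 2 (partial 1 f) x + c x * partial 2 (partial 2 f) x"
proof -
  have f: "Ck_on 1 U (partial i f)" for i using C1(4) by (simp add: Ck_on_2)
  have d: "g differentiable (at x)" if "Ck_on 1 U g" for g :: "real^2 \<Rightarrow> real"
    using that x by (simp add: Ck_on_1)
  have p: "partial i (\<lambda>y. g y * partial 1 f y + h y * partial 2 f y) x
      = (partial i g x * partial 1 f x + g x * partial i (partial 1 f) x)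
        + (partial i h x * partial 2 f x + h x * partial i (partial 2 f) x)"
    if "Ck_on 1 U g" "Ck_on 1 U h" for i g h
    by (intro partial_eqI has_partial_add has_partial_mult Ck_on_1_has_partial[OF _ x]
        differentiable_add differentiable_mult d f that)
  show ?thesis unfolding div_grad_def p[OF C1(1,2)] p[OF C1(2,3)] by (simp add: algebra_simps)
qed


text \<open>Green's identity for \<open>f\<close> and the test function \<open>\<Phi>\<close>: the
  integral of \<open>\<Phi> * div_grad f - f * div_grad \<Phi>\<close> vanishes. The subsolution
  inequality bounds the first term from below, and the concentrated part of the second yields a
  multiple of \<open>f x0\<close>. The smallness of \<open>r\<close> absorbs the errors into half of
  that multiple.\<close>

lemma max_le_integral:
  fixes a b c f w :: "real^2 \<Rightarrow> real" and x0 :: "real^2" and B r :: real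
  assumes B: "1 \<le> B" and r: "0 < r" "r \<le> 1 / (36992 * B ^ 6)"
    and U: "open U" "cball x0 r \<subseteq> U"
    and C1: "Ck_on 1 U a" "Ck_on 1 U b" "Ck_on 1 U c" and C2: "Ck_on 2 U f"
    and det: "a x0 * c x0 - (b x0)\<^sup>2 = 1" and pos: "0 < a x0"
    and bound0: "\<bar>a x0\<bar> \<le> B" "\<bar>b x0\<bar> \<le> B" "\<bar>c x0\<bar> \<le> B"
    and bound1: "\<And>i x. x \<in> cball x0 r \<Longrightarrow> \<bar>partial i a x\<bar> \<le> B"
      "\<And>i x. x \<in> cball x0 r \<Longrightarrow> \<bar>partial i b x\<bar> \<le> B"
      "\<And>i x. x \<in> cball x0 r \<Longrightarrow> \<bar>partial i c x\<bar> \<le> B"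
    and w: "\<And>x. x \<in> cball x0 r \<Longrightarrow> 0 \<le> w x \<and> w x \<le> B"
    and f: "\<And>x. x \<in> cball x0 r \<Longrightarrow> 0 \<le> f x \<and> f x \<le> f x0"
    and sub: "\<And>x. x \<in> cball x0 r \<Longrightarrow> - w x * f x \<le> div_grad a b c f x"
  shows "f x0 \<le> 768 * B\<^sup>2 / (pi * r\<^sup>2) * (\<integral>x. indicator (ball x0 r) x * f x \<partial>lborel)"
    and "integrable lborel (\<lambda>x. indicator (ball x0 r) x * f x)"
proof -
  let ?F = "f x0" and ?n = "\<lambda>x. norm (x - x0)"
  let ?I = "\<integral>x. indicator (ball x0 r) x * f x \<partial>lborel"
  have x0U: "x0 \<in> U" using U r by auto
  have contf: "continuous_on U f"
    using C2 by (auto simp: Ck_on_2 intro!: continuous_at_imp_continuous_on differentiable_imp_continuous_within)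
  show intf: "integrable lborel (\<lambda>x. indicator (ball x0 r) x * f x)"
  proof (rule integrable_bounded_support[of _ ?F x0 r])
    have "continuous_on (ball x0 r) f" using U by (intro continuous_on_subset[OF contf]) auto
    then show "(\<lambda>x. indicator (ball x0 r) x * f x) \<in> borel_measurable borel"
      using borel_measurable_continuous_on_indicator[of "ball x0 r" f] by simp
    show "\<bar>indicator (ball x0 r) x * f x\<bar> \<le> ?F" for x
      using f[of x] f[of x0] r by (auto simp: indicator_def)
  qed (auto simp: indicator_def)
  have F0: "0 \<le> ?F" using f[of x0] r by auto
  have I0: "0 \<le> ?I" using f by (intro integral_nonneg_AE always_eventually) (auto simp: indicator_def)
  show "?F \<le> 768 * B\<^sup>2 / (pi * r\<^sup>2) * ?I"
  proof (cases "?F = 0")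
    case True then show ?thesis using I0 by simp
  next
    case False
    with F0 have F: "0 < ?F" by simp
    \<comment> \<open>By \<open>q_lower\<close>, the set where \<open>q\<close> is at most
      \<open>S\<close> then lies in the disc where |x - x0|^2 is at most r^2/2, strictly inside the
      ball of radius \<open>r\<close>; moreover \<open>sqrt (B * S) = r / 2\<close>.\<close>
    define S where "S = r\<^sup>2 / (4 * B)"
    have S: "0 < S" using r B by (simp add: S_def)
    have "isCont f x0" using contf U x0U by (simp add: continuous_on_eq_continuous_at)
    then obtain \<delta> where \<delta>: "\<delta> > 0" "\<And>x. dist x x0 < \<delta> \<Longrightarrow> \<bar>f x - ?F\<bar> < ?F / 2"
      using F unfolding continuous_at dist_real_def Lim_at by (metis dist_self half_gt_zero zero_less_abs_iff diff_self abs_zero less_irrefl dist_pos_lt)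
    \<comment> \<open>Chosen so that the radius \<open>s = sqrt (\<epsilon> / (4 * B))\<close> used
      below is at most \<open>\<delta>\<close>: on that disc \<open>f\<close> is at least
      \<open>?F / 2\<close>, and \<open>q\<close> is at most \<open>\<epsilon>\<close> by
      \<open>q_upper\<close>.\<close>
    define \<epsilon> where "\<epsilon> = min S (4 * B * \<delta>\<^sup>2)"
    have \<epsilon>: "0 < \<epsilon>" "\<epsilon> \<le> S" and \<epsilon>\<delta>: "\<epsilon> \<le> 4 * B * \<delta>\<^sup>2"
      using S B \<delta> by (auto simp: \<epsilon>_def)
    interpret test_function x0 "a x0" "b x0" "c x0" B S \<epsilon>
      by unfold_locales (use B bound0 det pos S \<epsilon> in auto)
    define K where "K = {x. q x \<le> S}"
    have K: "K \<subseteq> ball x0 r"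
    proof
      fix x assume "x \<in> K"
      then have "2 * B * q x \<le> 2 * B * S" using B(1) by (simp add: K_def)
      then have "(?n x)\<^sup>2 \<le> 2 * B * S" using q_lower[of x] by (rule order_trans[rotated])
      also have "\<dots> < r\<^sup>2" using B(1) r by (simp add: S_def)
      finally show "x \<in> ball x0 r" using r by (simp add: dist_norm norm_minus_commute power_less_imp_less_base)
    qed
    have KU: "K \<subseteq> U" using K U(2) ball_subset_cball[of x0 r] by blast
    have "closed K" unfolding K_def
      by (intro closed_Collect_le continuous_test_function continuous_on_const)
    note zero = continuous_on_UNIV_zero_outside[OF _ U(1) this KU]
    have outside: "\<Phi> x = 0" "\<Phi>1 x = 0" "\<Phi>2 x = 0" "\<Phi>11 x = 0" "\<Phi>12 x = 0" "\<Phi>22 x = 0" if "x \<notin> K" for x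
      using test_function_eq_0[of x] that by (auto simp: K_def)
    \<comment> \<open>(\<open>X1\<close>, \<open>X2\<close>) is the Green field A (\<Phi> grad f - f
      grad \<Phi>), supported in \<open>K\<close>, and \<open>Y1\<close>, \<open>Y2\<close> are its
      derivatives in directions 1 and 2. In the sum \<open>Y1 + Y2\<close> the products of first
      derivatives of \<open>f\<close> and of \<open>\<Phi>\<close> cancel.\<close>
    define X1 where "X1 x = a x * (\<Phi> x * partial 1 f x - f x * \<Phi>1 x)
      + b x * (\<Phi> x * partial 2 f x - f x * \<Phi>2 x)" for x
    define X2 where "X2 x = b x * (\<Phi> x * partial 1 f x - f x * \<Phi>1 x)
      + c x * (\<Phi> x * partial 2 f x - f x * \<Phi>2 x)" for x
    define Y1 where "Y1 x = (partial 1 a x * (\<Phi> x * partial 1 f x - f x * \<Phi>1 x)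
       + a x * ((\<Phi>1 x * partial 1 f x + \<Phi> x * partial 1 (partial 1 f) x) - (partial 1 f x * \<Phi>1 x + f x * \<Phi>11 x)))
      + (partial 1 b x * (\<Phi> x * partial 2 f x - f x * \<Phi>2 x)
       + b x * ((\<Phi>1 x * partial 2 f x + \<Phi> x * partial 1 (partial 2 f) x) - (partial 1 f x * \<Phi>2 x + f x * \<Phi>12 x)))" for x
    define Y2 where "Y2 x = (partial 2 b x * (\<Phi> x * partial 1 f x - f x * \<Phi>1 x)
       + b x * ((\<Phi>2 x * partial 1 f x + \<Phi> x * partial 2 (partial 1 f) x) - (partial 2 f x * \<Phi>1 x + f x * \<Phi>12 x)))
      + (partial 2 c x * (\<Phi> x * partial 2 f x - f x * \<Phi>2 x)
       + c x * ((\<Phi>2 x * partial 2 f x + \<Phi> x * partial 2 (partial 2 f) x) - (partial 2 f x * \<Phi>2 x + f x * \<Phi>22 x)))" for x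
    have f1: "Ck_on 1 U (partial i f)" for i using C2 by (simp add: Ck_on_2)
    have cont: "continuous_on U a" "continuous_on U b" "continuous_on U c"
      "continuous_on U (partial i f)" "continuous_on U (partial i a)" "continuous_on U (partial i b)"
      "continuous_on U (partial i c)" "continuous_on U (partial i (partial j f))" for i j
      using C1 f1 by (auto simp: Ck_on_1_continuous)
    have fp: "has_partial i f (partial i f x) x" if "x \<in> U" for i x
      using C2 that by (simp add: Ck_on_2 has_partial_partial)
    have X0: "X1 x = 0" "X2 x = 0" "Y1 x = 0" "Y2 x = 0" if "x \<notin> K" for x
      by (simp_all add: X1_def X2_def Y1_def Y2_def outside[OF that])
    have hp0: "has_partial i X 0 x" if "x \<notin> K" "\<And>x. x \<notin> K \<Longrightarrow> X x = 0" for X i x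
      by (rule has_partial_cong[of "- K" x "\<lambda>_. 0"])
        (use that \<open>closed K\<close> in \<open>auto intro: has_partial_const\<close>)
    have X1: "has_partial 1 X1 (Y1 x) x" for x
    proof (cases "x \<in> K")
      case True
      then have "x \<in> U" using KU by auto
      show ?thesis unfolding X1_def[abs_def] Y1_def
        by (intro has_partial_add has_partial_mult has_partial_diff fp has_partial_\<Phi> has_partial_\<Phi>'
            Ck_on_1_has_partial[OF C1(1)] Ck_on_1_has_partial[OF C1(2)] Ck_on_1_has_partial[OF f1] \<open>x \<in> U\<close>)
    qed (use hp0 X0 in auto)
    have X2: "has_partial 2 X2 (Y2 x) x" for x
    proof (cases "x \<in> K")
      case True
      then have "x \<in> U" using KU by auto
      show ?thesis unfolding X2_def[abs_def] Y2_def
        by (intro has_partial_add has_partial_mult has_partial_diff fp has_partial_\<Phi> has_partial_\<Phi>'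
            Ck_on_1_has_partial[OF C1(2)] Ck_on_1_has_partial[OF C1(3)] Ck_on_1_has_partial[OF f1] \<open>x \<in> U\<close>)
    qed (use hp0 X0 in auto)
    have contU: "continuous_on U X1" "continuous_on U X2" "continuous_on U Y1" "continuous_on U Y2"
      unfolding X1_def[abs_def] X2_def[abs_def] Y1_def[abs_def] Y2_def[abs_def]
      by (intro continuous_intros cont contf continuous_test_function)+
    have contX: "continuous_on UNIV X1" "continuous_on UNIV X2" "continuous_on UNIV Y1" "continuous_on UNIV Y2"
      using zero[OF contU(1) X0(1)] zero[OF contU(2) X0(2)] zero[OF contU(3) X0(3)] zero[OF contU(4) X0(4)]
      by blast+
    have X0': "X1 x = 0" "X2 x = 0" "Y1 x = 0" "Y2 x = 0" if "x \<notin> ball x0 r" for x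
      using X0[of x] that K by (metis subsetD)+
    note i1 = integral_partial_eq_0[OF X1 contX(1,3) X0'(1,3)]
    note i2 = integral_partial_eq_0[OF X2 contX(2,4) X0'(2,4)]
    have int0: "(\<integral>x. Y1 x + Y2 x \<partial>lborel) = 0"
      using i1 i2 by (simp add: Bochner_Integration.integral_add)
    define s where "s = sqrt (\<epsilon> / (4 * B))"
    have s: "0 < s" "s\<^sup>2 = \<epsilon> / (4 * B)" using \<epsilon> B(1) by (auto simp: s_def)
    \<comment> \<open>\<open>div_grad a b c \<Phi>\<close> written out, with both mixed second
      derivatives equal to \<open>\<Phi>12\<close>.\<close>
    define M where "M x = a x * \<Phi>11 x + 2 * b x * \<Phi>12 x + c x * \<Phi>22 x
      + (partial 1 a x + partial 2 b x) * \<Phi>1 x + (partial 1 b x + partial 2 c x) * \<Phi>2 x" for x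
    \<comment> \<open>The three terms are the concentrated mass near \<open>x0\<close>, the loss
      from the cut-off, and the singular error. The factor 578 is 576 from freezing the coefficients
      plus 2 from the zeroth-order term.\<close>
    define low where "low x = ?F / (2 * \<epsilon>) * indicator (ball x0 s) x
        - 12 / S * (indicator (ball x0 r) x * f x)
        - 578 * B ^ 5 * ?F * (indicator (ball x0 r) x / ?n x)" for x
    have low: "low x \<le> Y1 x + Y2 x" if "x \<noteq> x0" for x
    proof (cases "q x < S")
      case False
      have "x \<notin> ball x0 s"
      proof
        assume "x \<in> ball x0 s"
        then have "(?n x)\<^sup>2 < s\<^sup>2" by (intro power_strict_mono) (auto simp: dist_norm norm_minus_commute)
        then have "4 * B * (?n x)\<^sup>2 < \<epsilon>" using s B(1) by (simp add: field_simps)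
        then show False using q_upper[of x] False \<epsilon> by linarith
      qed
      moreover have "Y1 x + Y2 x = 0"
        using test_function_eq_0[of x] False by (simp add: Y1_def Y2_def)
      moreover have "0 \<le> 12 / S * (indicator (ball x0 r) x * f x)"
        using f[of x] S by (auto simp: indicator_def)
      moreover have "0 \<le> 578 * B ^ 5 * ?F * (indicator (ball x0 r) x / ?n x)"
        using F B(1) by (auto simp: indicator_def)
      ultimately show ?thesis by (simp add: low_def)
    next
      case True
      then have "x \<in> K" by (simp add: K_def)
      then have "x \<in> ball x0 r" using K by blast
      then have xr: "x \<in> cball x0 r" "x \<in> U" "indicator (ball x0 r) x = (1::real)"
        using U(2) ball_subset_cball[of x0 r] by auto
      have n: "?n x > 0" using that by simp
      note fx = f[OF xr(1)]
      have eq: "Y1 x + Y2 x = \<Phi> x * div_grad a b c f x - f x * M x"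
        unfolding div_grad_eq[OF C1 C2 xr(2)] Y1_def Y2_def M_def by (simp add: algebra_simps)
      \<comment> \<open>\<open>4 * sqrt (B * S) = 2 * r\<close> and
        \<open>r \<le> 1\<close>.\<close>
      have "\<Phi> x \<le> 2 / ?n x"
      proof -
        have sqrt: "sqrt (B * S) = r / 2" using r B(1) by (simp add: S_def real_sqrt_divide)
        have "1 \<le> 36992 * B ^ 6" using one_le_power[OF B(1), of 6] by linarith
        moreover have "1 / y \<le> 1" if "1 \<le> y" for y :: real using that by simp
        ultimately have "r \<le> 1" using order_trans[OF r(2)] by blast
        then have "4 * sqrt (B * S) / ?n x \<le> 2 / ?n x"
          using n sqrt by (intro divide_right_mono) auto
        then show ?thesis using \<Phi>_le[OF True that] by linarith
      qed
      then have "\<Phi> x * (w x * f x) \<le> 2 / ?n x * (B * ?F)"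
        using w[OF xr(1)] fx n B(1) by (intro mult_mono) auto
      moreover have "2 / ?n x * (B * ?F) \<le> 2 * B ^ 5 * ?F / ?n x"
      proof -
        have "B \<le> B ^ 5" using B(1) power_increasing[of 1 5 B] by simp
        then show ?thesis using F n by (simp add: divide_right_mono)
      qed
      moreover have "\<Phi> x * (- w x * f x) \<le> \<Phi> x * div_grad a b c f x"
        using sub[OF xr(1)] \<Phi>_nonneg[OF True that] by (intro mult_left_mono) auto
      ultimately have p1: "- (2 * B ^ 5 * ?F / ?n x) \<le> \<Phi> x * div_grad a b c f x"
        by simp
      \<comment> \<open>Here 576 = 4 * 136 + 2 * 16: four second-order coefficient differences, the
        mixed one counted twice, and two first-order terms with derivatives of the
        coefficients.\<close>
      have M: "4 * \<epsilon> / (q x + \<epsilon>)\<^sup>2 - 12 / S - 576 * B ^ 5 / ?n x \<le> - M x"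
      proof -
        have lip: "\<bar>g x - g x0\<bar> \<le> 2 * B * ?n x"
          if "Ck_on 1 U g" "\<And>i x. x \<in> cball x0 r \<Longrightarrow> \<bar>partial i g x\<bar> \<le> B" for g :: "real^2 \<Rightarrow> real"
          using that xr(1) r U by (intro partials_Lipschitz[of "cball x0 r"]) (auto simp: Ck_on_1)
        have prod: "\<bar>u * v\<bar> \<le> 136 * B ^ 5 / ?n x"
          if "\<bar>u\<bar> \<le> 2 * B * ?n x" "\<bar>v\<bar> \<le> 68 * B ^ 4 / (?n x)\<^sup>2" for u v
        proof -
          have "\<bar>u * v\<bar> \<le> 2 * B * ?n x * (68 * B ^ 4 / (?n x)\<^sup>2)"
            unfolding abs_mult using that B(1) by (intro mult_mono) auto
          also have "\<dots> = 136 * B ^ 5 / ?n x"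
            using n by (simp add: power2_eq_square eval_nat_numeral)
          finally show ?thesis .
        qed
        have prod': "\<bar>(u + u') * v\<bar> \<le> 16 * B ^ 5 / ?n x"
          if "\<bar>u\<bar> \<le> B" "\<bar>u'\<bar> \<le> B" "\<bar>v\<bar> \<le> 8 * B\<^sup>2 / ?n x" for u u' v
        proof -
          have "\<bar>(u + u') * v\<bar> \<le> 2 * B * (8 * B\<^sup>2 / ?n x)"
            unfolding abs_mult using that B(1) by (intro mult_mono) auto
          also have "\<dots> = 16 * B ^ 3 / ?n x" by (simp add: eval_nat_numeral)
          also have "\<dots> \<le> 16 * B ^ 5 / ?n x"
            using B(1) by (intro divide_right_mono mult_left_mono power_increasing) auto
          finally show ?thesis .
        qed
        define k where "k = B ^ 5 / ?n x"
        have e1: "\<bar>(a x - a x0) * \<Phi>11 x\<bar> \<le> 136 * k" "\<bar>(b x - b x0) * \<Phi>12 x\<bar> \<le> 136 * k"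
          "\<bar>(c x - c x0) * \<Phi>22 x\<bar> \<le> 136 * k"
          using prod[OF lip[OF C1(1) bound1(1)] \<Phi>11_le[OF True that]]
            prod[OF lip[OF C1(2) bound1(2)] \<Phi>12_le[OF True that]]
            prod[OF lip[OF C1(3) bound1(3)] \<Phi>22_le[OF True that]] by (simp_all add: k_def)
        have e2: "\<bar>(partial 1 a x + partial 2 b x) * \<Phi>1 x\<bar> \<le> 16 * k"
          "\<bar>(partial 1 b x + partial 2 c x) * \<Phi>2 x\<bar> \<le> 16 * k"
          using prod'[OF bound1(1)[OF xr(1)] bound1(2)[OF xr(1)] \<Phi>1_le[OF True that]]
            prod'[OF bound1(2)[OF xr(1)] bound1(3)[OF xr(1)] \<Phi>2_le[OF True that]] by (simp_all add: k_def)
        define M0 where "M0 = a x0 * \<Phi>11 x + 2 * b x0 * \<Phi>12 x + c x0 * \<Phi>22 x"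
        have "M x = M0 + (a x - a x0) * \<Phi>11 x + 2 * ((b x - b x0) * \<Phi>12 x) + (c x - c x0) * \<Phi>22 x
          + (partial 1 a x + partial 2 b x) * \<Phi>1 x + (partial 1 b x + partial 2 c x) * \<Phi>2 x"
          by (simp add: M_def M0_def algebra_simps)
        moreover have "4 * \<epsilon> / (q x + \<epsilon>)\<^sup>2 - 12 / S \<le> - M0"
          using frozen_operator[OF True] by (simp add: M0_def)
        moreover have "576 * B ^ 5 / ?n x = 576 * k" by (simp add: k_def)
        ultimately show ?thesis using e1 e2 unfolding abs_le_iff by linarith
      qed
      have p2: "f x * (4 * \<epsilon> / (q x + \<epsilon>)\<^sup>2) - 12 / S * f x - 576 * B ^ 5 * ?F / ?n x \<le> - (f x * M x)"
      proof -
        have "f x * (4 * \<epsilon> / (q x + \<epsilon>)\<^sup>2 - 12 / S - 576 * B ^ 5 / ?n x) \<le> f x * (- M x)"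
          using M fx by (intro mult_left_mono) auto
        moreover have "f x * (576 * B ^ 5 / ?n x) \<le> ?F * (576 * B ^ 5 / ?n x)"
          using fx n B(1) by (intro mult_right_mono) auto
        ultimately show ?thesis by (simp add: algebra_simps)
      qed
      \<comment> \<open>On the small disc \<open>q x + \<epsilon> \<le> 2 * \<epsilon>\<close>, so
        the kernel is at least \<open>1 / \<epsilon>\<close>, while \<open>f\<close> is at least
        half its maximum.\<close>
      have p3: "?F / (2 * \<epsilon>) * indicator (ball x0 s) x \<le> f x * (4 * \<epsilon> / (q x + \<epsilon>)\<^sup>2)"
      proof (cases "x \<in> ball x0 s")
        case True
        then have ns: "?n x < s" by (simp add: dist_norm norm_minus_commute)
        then have "(?n x)\<^sup>2 < s\<^sup>2" by (intro power_strict_mono) auto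
        then have "4 * B * (?n x)\<^sup>2 \<le> \<epsilon>" using s B(1) by (simp add: field_simps)
        then have "q x \<le> \<epsilon>" using q_upper[of x] by linarith
        then have "(q x + \<epsilon>)\<^sup>2 \<le> (2 * \<epsilon>)\<^sup>2" using q_nonneg[of x] \<epsilon> by (intro power_mono) auto
        then have "4 * \<epsilon> / (2 * \<epsilon>)\<^sup>2 \<le> 4 * \<epsilon> / (q x + \<epsilon>)\<^sup>2"
          using q_nonneg[of x] \<epsilon> by (intro divide_left_mono) auto
        then have le: "1 / \<epsilon> \<le> 4 * \<epsilon> / (q x + \<epsilon>)\<^sup>2" using \<epsilon> by (simp add: power2_eq_square)
        have "s\<^sup>2 \<le> \<delta>\<^sup>2" using \<epsilon>\<delta> B(1) by (simp add: s field_simps)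
        then have "s \<le> \<delta>" using \<delta>(1) by (rule power2_le_imp_le[OF _ less_imp_le])
        then have "\<bar>f x - ?F\<bar> < ?F / 2" using \<delta>(2)[of x] ns by (simp add: dist_norm)
        then have "?F / 2 \<le> f x" unfolding abs_less_iff by linarith
        then have "?F / 2 * (1 / \<epsilon>) \<le> f x * (4 * \<epsilon> / (q x + \<epsilon>)\<^sup>2)"
          using le fx \<epsilon> by (intro mult_mono) auto
        then show ?thesis using True by simp
      qed (use fx \<epsilon> in simp)
      have "low x = ?F / (2 * \<epsilon>) * indicator (ball x0 s) x - 12 / S * f x - 576 * B ^ 5 * ?F / ?n x
        - 2 * B ^ 5 * ?F / ?n x"
        using n by (simp add: low_def xr(3) field_simps)
      then show ?thesis unfolding eq using p1 p2 p3 by linarith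
    qed
    note k = integral_inverse_norm_ball[OF r(1), of x0]
    have ints: "integrable lborel (indicator (ball x0 s) :: _ \<Rightarrow> real)"
      by (intro integrable_real_indicator emeasure_lborel_ball_finite) simp
    define N where "N = 578 * B ^ 5 * ?F * (\<integral>x. indicator (ball x0 r) x / ?n x \<partial>lborel)"
    define J where "J = 12 / S * ?I"
    \<comment> \<open>Half of the concentrated mass: \<open>?F / (2 * \<epsilon>)\<close> times the
      area \<open>pi * \<epsilon> / (4 * B)\<close> of the small disc is \<open>2 * P\<close>. This
      is where \<open>\<epsilon>\<close> drops out.\<close>
    define P where "P = ?F * pi / (16 * B)"
    have "?F / (2 * \<epsilon>) * measure lborel (ball x0 s) = ?F / (2 * \<epsilon>) * (pi * s\<^sup>2)"
      using s content_ball[of s x0] by (simp add: unit_ball_vol_2)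
    also have "\<dots> = 2 * P" using \<epsilon> by (simp add: s P_def)
    finally have "2 * P - J - N = (\<integral>x. low x \<partial>lborel)"
      unfolding low_def N_def J_def using ints intf k(1)
      by (simp add: Bochner_Integration.integral_diff del: times_divide_eq_right times_divide_eq_left)
    also have "\<dots> \<le> (\<integral>x. Y1 x + Y2 x \<partial>lborel)"
    proof (rule integral_mono_AE)
      show "integrable lborel low" unfolding low_def[abs_def]
        by (intro Bochner_Integration.integrable_diff integrable_mult_right ints intf k(1))
      show "AE x in lborel. low x \<le> Y1 x + Y2 x"
        using AE_lborel_singleton[of x0] by eventually_elim (rule low)
    qed (use i1 i2 in auto)
    finally have "2 * P - J - N \<le> 0" using int0 by simp
    moreover have "N \<le> P"
    proof -
      have "N \<le> 578 * B ^ 5 * ?F * (4 * pi * r)"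
        unfolding N_def using k(2) F B(1) by (intro mult_left_mono) auto
      \<comment> \<open>This fixes the smallness of \<open>r\<close>: 36992 = 578 * 4 * 16, which
        makes the singular error at most \<open>P\<close>.\<close>
      also have "\<dots> \<le> 578 * B ^ 5 * ?F * (4 * pi * (1 / (36992 * B ^ 6)))"
        using r F B(1) by (intro mult_left_mono) auto
      also have "\<dots> = P" using B(1) by (simp add: P_def eval_nat_numeral)
      finally show ?thesis .
    qed
    ultimately have "?F * pi / (16 * B) \<le> 12 / S * ?I" unfolding P_def[symmetric] J_def[symmetric] by linarith
    \<comment> \<open>768 = 16 * 12 * 4, from \<open>P\<close>, the cut-off loss
      \<open>12 / S\<close>, and \<open>S = r\<^sup>2 / (4 * B)\<close>.\<close>
    then show ?thesis using r B(1) by (simp add: S_def field_simps power2_eq_square)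
  qed
qed

section \<open>Calculus of \<open>C\<^sup>1\<close> functions\<close>

lemma partial_cong:
  assumes "open U" "x \<in> U" "\<And>y. y \<in> U \<Longrightarrow> f y = g y"
  shows "partial i f x = partial i g x"
proof -
  have "(f has_derivative D) (at x) \<longleftrightarrow> (g has_derivative D) (at x)" for D
    using has_derivative_transform_within_open[OF _ assms(1,2), of f D UNIV g]
      has_derivative_transform_within_open[OF _ assms(1,2), of g D UNIV f] assms(3) by auto
  then show ?thesis by (simp add: partial_def frechet_derivative_def)
qed

lemma Ck_on_cong:
  assumes "open U" "\<And>y. y \<in> U \<Longrightarrow> f y = g y" "Ck_on k U f"
  shows "Ck_on k U g"
  using assms(2,3)
proof (induction k arbitrary: f g)
  case 0
  then show ?case using continuous_on_cong[of U U f g] by simp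
next
  case (Suc k)
  have "g differentiable (at x)" if "x \<in> U" for x
    using Suc.prems that has_derivative_transform_within_open[OF _ assms(1) that, of f _ UNIV g]
    unfolding differentiable_def Ck_on.simps by blast
  moreover have "Ck_on k U (partial i g)" for i
  proof (rule Suc.IH[of "partial i f"])
    show "partial i f y = partial i g y" if "y \<in> U" for y
      using Suc.prems(1) by (rule partial_cong[OF assms(1) that])
  qed (use Suc.prems in auto)
  ultimately show ?case by simp
qed

lemma Ck_on_bounded_linear:
  assumes "open U" "bounded_linear L" "Ck_on k U f"
  shows "Ck_on k U (\<lambda>x. L (f x))"
  using assms(3)
proof (induction k arbitrary: f)
  case 0
  then show ?case by (auto intro!: bounded_linear.continuous_on[OF assms(2)])
next
  case (Suc k)
  have der: "((\<lambda>x. L (f x)) has_derivative (\<lambda>v. L (frechet_derivative f (at x) v))) (at x)"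
    if "x \<in> U" for x
    using Suc.prems that frechet_derivative_works
    by (intro bounded_linear.has_derivative[OF assms(2)]) auto
  have "L (partial i f x) = partial i (\<lambda>x. L (f x)) x" if "x \<in> U" for x i
    using fun_cong[OF frechet_derivative_at[OF der[OF that]]] by (simp add: partial_def)
  then have "Ck_on k U (partial i (\<lambda>x. L (f x)))" for i
    by (rule Ck_on_cong[OF assms(1) _ Suc.IH[of "partial i f"]]) (use Suc.prems in auto)
  then show ?case using der by (auto simp: differentiable_def)
qed

lemma Ck_on_mono: "Ck_on (Suc k) U f \<Longrightarrow> Ck_on k U f"
proof (induction k arbitrary: f)
  case 0
  then show ?case by (auto intro!: continuous_at_imp_continuous_on differentiable_imp_continuous_within)
qed auto

lemma Ck_on_1I:
  assumes "open U" "\<And>x. x \<in> U \<Longrightarrow> f differentiable (at x)"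
    and "\<And>i x. x \<in> U \<Longrightarrow> has_partial i f (d i x) x" "\<And>i. continuous_on U (d i)"
  shows "Ck_on 1 U f"
  unfolding Ck_on_1
proof (intro conjI ballI allI)
  fix i show "continuous_on U (partial i f)"
    by (rule continuous_on_eq[OF assms(4)]) (simp add: partial_eqI[OF assms(2,3)])
qed (rule assms(2))

lemma Ck_on_1_const: "open U \<Longrightarrow> Ck_on 1 U (\<lambda>_. c :: real)"
  by (rule Ck_on_1I[where d = "\<lambda>_ _. 0"]) (auto intro: has_partial_const)

lemma Ck_on_1_D:
  "Ck_on 1 U f \<Longrightarrow> x \<in> U \<Longrightarrow> f differentiable (at x)" "Ck_on 1 U f \<Longrightarrow> continuous_on U (partial i f)"
  by (auto simp: Ck_on_1)

lemma Ck_on_1_mult: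
  fixes f g :: "real^2 \<Rightarrow> real"
  assumes "open U" "Ck_on 1 U f" "Ck_on 1 U g"
  shows "Ck_on 1 U (\<lambda>x. f x * g x)"
  by (rule Ck_on_1I[OF assms(1), where d = "\<lambda>i x. partial i f x * g x + f x * partial i g x"])
    (intro has_partial_mult differentiable_mult continuous_intros Ck_on_1_has_partial[of U] Ck_on_1_continuous
      Ck_on_1_D[of U] assms; assumption)+

lemma Ck_on_1_add:
  fixes f g :: "real^2 \<Rightarrow> real"
  assumes "open U" "Ck_on 1 U f" "Ck_on 1 U g"
  shows "Ck_on 1 U (\<lambda>x. f x + g x)"
  by (rule Ck_on_1I[OF assms(1), where d = "\<lambda>i x. partial i f x + partial i g x"])
    (intro has_partial_add differentiable_add continuous_intros Ck_on_1_has_partial[of U] Ck_on_1_continuous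
      Ck_on_1_D[of U] assms; assumption)+

lemma Ck_on_1_diff:
  fixes f g :: "real^2 \<Rightarrow> real"
  assumes "open U" "Ck_on 1 U f" "Ck_on 1 U g"
  shows "Ck_on 1 U (\<lambda>x. f x - g x)"
  by (rule Ck_on_1I[OF assms(1), where d = "\<lambda>i x. partial i f x - partial i g x"])
    (intro has_partial_diff differentiable_diff continuous_intros Ck_on_1_has_partial[of U] Ck_on_1_continuous
      Ck_on_1_D[of U] assms; assumption)+

lemma Ck_on_1_compose:
  fixes f :: "real^2 \<Rightarrow> real"
  assumes "open U" "Ck_on 1 U f" "\<And>x. x \<in> U \<Longrightarrow> f x \<in> A"
    and "\<And>t. t \<in> A \<Longrightarrow> (\<phi> has_real_derivative \<phi>' t) (at t)" "continuous_on A \<phi>'"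
  shows "Ck_on 1 U (\<lambda>x. \<phi> (f x))"
proof (rule Ck_on_1I[OF assms(1), where d = "\<lambda>i x. \<phi>' (f x) * partial i f x"])
  fix x assume x: "x \<in> U"
  then have \<phi>: "(\<phi> has_real_derivative \<phi>' (f x)) (at (f x))" using assms by auto
  then show "has_partial i (\<lambda>x. \<phi> (f x)) (\<phi>' (f x) * partial i f x) x" for i
    using assms(2) x by (intro has_partial_chain Ck_on_1_has_partial)
  have "\<phi> differentiable at (f x)" using \<phi> by (meson real_differentiable_def)
  then show "(\<lambda>x. \<phi> (f x)) differentiable (at x)"
    using differentiable_compose[of \<phi> f x UNIV] Ck_on_1_D(1)[OF assms(2) x] by simp
next
  fix i show "continuous_on U (\<lambda>x. \<phi>' (f x) * partial i f x)"
    using assms by (intro continuous_on_mult continuous_on_compose2[OF assms(5)] Ck_on_1_D(2)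
      Ck_on_1_continuous) auto
qed

lemma Ck_on_1_inverse:
  fixes f :: "real^2 \<Rightarrow> real"
  assumes "open U" "Ck_on 1 U f" "\<And>x. x \<in> U \<Longrightarrow> 0 < f x"
  shows "Ck_on 1 U (\<lambda>x. inverse (f x))"
  by (rule Ck_on_1_compose[OF assms(1,2), where A = "{0<..}" and \<phi>' = "\<lambda>t. - inverse (t\<^sup>2)"])
    (use assms(3) in \<open>auto intro!: derivative_eq_intros continuous_intros simp: power2_eq_square\<close>)

lemma Ck_on_1_sqrt:
  fixes f :: "real^2 \<Rightarrow> real"
  assumes "open U" "Ck_on 1 U f" "\<And>x. x \<in> U \<Longrightarrow> 0 < f x"
  shows "Ck_on 1 U (\<lambda>x. sqrt (f x))"
  by (rule Ck_on_1_compose[OF assms(1,2), where A = "{0<..}" and \<phi>' = "\<lambda>t. inverse (sqrt t) / 2"])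
    (use assms(3) in \<open>auto intro!: derivative_eq_intros continuous_intros\<close>)

text \<open>Two applications of the mean value theorem, first in direction \<open>i\<close> and then
  in direction \<open>j\<close>. The left side is symmetric in \<open>i\<close> and
  \<open>j\<close>. The evaluation points have distance at most 2h from \<open>x\<close>, hence the
  radius 3h for a strict inclusion.\<close>

lemma second_difference:
  fixes f :: "real^2 \<Rightarrow> real"
  assumes C2: "Ck_on 2 U f" and h: "0 < h" and U: "ball x (3 * h) \<subseteq> U"
  shows "\<exists>y\<in>ball x (3 * h). f (x + h *\<^sub>R axis i 1 + h *\<^sub>R axis j 1) - f (x + h *\<^sub>R axis i 1)
    - f (x + h *\<^sub>R axis j 1) + f x = h\<^sup>2 * partial j (partial i f) y"
proof -
  let ?e = "\<lambda>i. axis i 1 :: real^2"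
  have inball: "x + s *\<^sub>R ?e i + t *\<^sub>R ?e j \<in> ball x (3 * h)" if "0 \<le> s" "s \<le> h" "0 \<le> t" "t \<le> h" for s t
  proof -
    have "norm (s *\<^sub>R ?e i + t *\<^sub>R ?e j) \<le> norm (s *\<^sub>R ?e i) + norm (t *\<^sub>R ?e j)" by (rule norm_triangle_ineq)
    also have "\<dots> < 3 * h" using that h by simp
    finally have "norm (s *\<^sub>R ?e i + t *\<^sub>R ?e j) < 3 * h" .
    moreover have "norm v < 3 * h \<Longrightarrow> x + v \<in> ball x (3 * h)" for v by (simp add: dist_norm)
    ultimately show ?thesis unfolding add.assoc by blast
  qed
  have f1: "has_partial i f (partial i f y) y" if "y \<in> ball x (3 * h)" for y
    using C2 U that by (intro has_partial_partial) (auto simp: Ck_on_2)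
  have f2: "has_partial j (partial i f) (partial j (partial i f) y) y" if "y \<in> ball x (3 * h)" for y
    using C2 U that by (intro Ck_on_1_has_partial[of U]) (auto simp: Ck_on_2)
  define g where "g s = f (x + h *\<^sub>R ?e j + s *\<^sub>R ?e i) - f (x + s *\<^sub>R ?e i)" for s
  define g' where "g' s = partial i f (x + h *\<^sub>R ?e j + s *\<^sub>R ?e i) - partial i f (x + s *\<^sub>R ?e i)" for s
  have "(g has_real_derivative g' s) (at s)" if "0 \<le> s" "s \<le> h" for s
    unfolding g_def[abs_def] g'_def
  proof (intro DERIV_diff has_partial_line f1)
    show "x + h *\<^sub>R ?e j + s *\<^sub>R ?e i \<in> ball x (3 * h)"
      using inball[of s h] that h unfolding add.assoc by (subst add.commute[of "h *\<^sub>R _"]) simp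
    show "x + s *\<^sub>R ?e i \<in> ball x (3 * h)" using inball[of s 0] that h by simp
  qed
  then obtain s where s: "0 < s" "s < h" "g h - g 0 = (h - 0) * g' s"
    using MVT2[of 0 h g g'] h by blast
  have "((\<lambda>t. partial i f (x + s *\<^sub>R ?e i + t *\<^sub>R ?e j)) has_real_derivative
      partial j (partial i f) (x + s *\<^sub>R ?e i + t *\<^sub>R ?e j)) (at t)" if "0 \<le> t" "t \<le> h" for t
    using that s by (intro has_partial_line f2 inball) auto
  then obtain t where t: "0 < t" "t < h" "partial i f (x + s *\<^sub>R ?e i + h *\<^sub>R ?e j)
      - partial i f (x + s *\<^sub>R ?e i + 0 *\<^sub>R ?e j)
      = (h - 0) * partial j (partial i f) (x + s *\<^sub>R ?e i + t *\<^sub>R ?e j)"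
    using MVT2[of 0 h "\<lambda>t. partial i f (x + s *\<^sub>R ?e i + t *\<^sub>R ?e j)"
      "\<lambda>t. partial j (partial i f) (x + s *\<^sub>R ?e i + t *\<^sub>R ?e j)"] h by blast
  have comm: "x + h *\<^sub>R ?e j + s *\<^sub>R ?e i = x + s *\<^sub>R ?e i + h *\<^sub>R ?e j" for s
    by (simp only: add.assoc add.commute[of "h *\<^sub>R _"])
  have "g' s = h * partial j (partial i f) (x + s *\<^sub>R ?e i + t *\<^sub>R ?e j)"
    using t(3) unfolding g'_def comm by simp
  then have "g h - g 0 = h\<^sup>2 * partial j (partial i f) (x + s *\<^sub>R ?e i + t *\<^sub>R ?e j)"
    using s(3) by (simp add: power2_eq_square)
  then show ?thesis using inball[of s t] s t unfolding g_def comm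
    by (intro bexI[of _ "x + s *\<^sub>R ?e i + t *\<^sub>R ?e j"]) simp_all
qed

text \<open>The symmetric second difference represents each mixed derivative at some nearby point,
  so the two take a common value at points arbitrarily close to \<open>x\<close>; continuity forbids
  a gap between them at \<open>x\<close>.\<close>

lemma partial_commute:
  fixes f :: "real^2 \<Rightarrow> real"
  assumes C2: "Ck_on 2 U f" and U: "open U" "x \<in> U"
  shows "partial i (partial j f) x = partial j (partial i f) x"
proof (rule ccontr)
  let ?A = "partial i (partial j f)" and ?B = "partial j (partial i f)"
  assume "?A x \<noteq> ?B x"
  define e where "e = dist (?B x) (?A x) / 2"
  have e: "e > 0" using \<open>?A x \<noteq> ?B x\<close> by (simp add: e_def)
  have "continuous_on U ?A" "continuous_on U ?B" using C2 by (auto simp: Ck_on_2 Ck_on_1)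
  then have "isCont ?A x" "isCont ?B x" using U by (auto simp: continuous_on_eq_continuous_at)
  then obtain d1 d2 where d: "d1 > 0" "d2 > 0"
    "\<And>y. dist y x < d1 \<Longrightarrow> dist (?A y) (?A x) < e" "\<And>y. dist y x < d2 \<Longrightarrow> dist (?B y) (?B x) < e"
    using e unfolding continuous_at_eps_delta by metis
  obtain d3 where d3: "d3 > 0" "ball x d3 \<subseteq> U" using U open_contains_ball by blast
  define h where "h = min d1 (min d2 d3) / 3"
  have h: "h > 0" "3 * h \<le> d1" "3 * h \<le> d2" "ball x (3 * h) \<subseteq> U"
    using d d3 by (auto simp: h_def)
  obtain y z where yz: "y \<in> ball x (3 * h)" "z \<in> ball x (3 * h)" and "h\<^sup>2 * ?B y = h\<^sup>2 * ?A z"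
    using second_difference[OF C2 h(1,4), of i j] second_difference[OF C2 h(1,4), of j i]
    by (auto simp: algebra_simps)
  then have "?B y = ?A z" using h by simp
  moreover have "dist (?B y) (?B x) < e" "dist (?A z) (?A x) < e"
    using yz h by (auto intro!: d(3,4) simp: dist_commute[of _ x])
  ultimately have "dist (?A z) (?B x) < e" "dist (?A z) (?A x) < e" by simp_all
  then have "dist (?B x) (?A x) < 2 * e"
    using dist_triangle3[of "?B x" "?A x" "?A z"] by linarith
  then show False by (simp add: e_def)
qed

section \<open>Curvature of a conformal metric\<close>

text \<open>\<open>matrix_inv\<close> is a choice term, so only its defining equations are
  available. Combining the equations for a left inverse with the adjugate is Cramer's rule.\<close>

lemma matrix_inv_2:
  fixes A :: "real^2^2"
  assumes "det A \<noteq> 0"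
  shows "matrix_inv A $ 1 $ 1 = A $ 2 $ 2 / det A" "matrix_inv A $ 1 $ 2 = - A $ 1 $ 2 / det A"
    "matrix_inv A $ 2 $ 1 = - A $ 2 $ 1 / det A" "matrix_inv A $ 2 $ 2 = A $ 1 $ 1 / det A"
proof -
  define C :: "real^2^2" where "C = matrix_inv A"
  have "invertible A" using assms by (simp add: invertible_det_nz)
  then have CA: "C ** A = mat 1"
    unfolding C_def matrix_inv_def invertible_def by (rule someI2_ex) blast
  have e: "C $ i $ 1 * A $ 1 $ j + C $ i $ 2 * A $ 2 $ j = (if i = j then 1 else 0)" for i j
    using arg_cong[OF CA, of "\<lambda>M. M $ i $ j"] by (simp add: matrix_matrix_mult_def sum_2 mat_def)
  have D: "det A = A$1$1 * A$2$2 - A$1$2 * A$2$1" by (rule det_2)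
  have row: "C $ i $ 1 * det A = (if i = 1 then 1 else 0) * A$2$2 - (if i = 2 then 1 else 0) * A$2$1"
    "C $ i $ 2 * det A = (if i = 2 then 1 else 0) * A$1$1 - (if i = 1 then 1 else 0) * A$1$2" for i
    unfolding D e[of i 1, symmetric] e[of i 2, symmetric] by (simp_all add: algebra_simps)
  show "matrix_inv A $ 1 $ 1 = A $ 2 $ 2 / det A" "matrix_inv A $ 1 $ 2 = - A $ 1 $ 2 / det A"
    "matrix_inv A $ 2 $ 1 = - A $ 2 $ 1 / det A" "matrix_inv A $ 2 $ 2 = A $ 1 $ 1 / det A"
    using row[of 1] row[of 2] assms unfolding C_def[symmetric] by (simp_all add: field_simps)
qed

text \<open>Here \<open>gij\<close> and \<open>dkgij\<close> stand for the metric and its first partials, \<open>Ckij\<close> for the Christoffel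
  symbols with upper index \<open>k\<close>, \<open>vi\<close> and \<open>vij\<close> for the partials of the conformal exponent (\<open>vij\<close> is
  differentiated by \<open>i\<close> last) and \<open>Wk\<close>, \<open>diWk\<close> for its gradient.\<close>

lemma conformal_curvature_identity:
  fixes g11 g12 g22 :: real
  assumes metric: "d1g11 = 2 * (g11 * C111 + g12 * C211)" "d2g11 = 2 * (g11 * C112 + g12 * C212)"
      "d1g22 = 2 * (g12 * C112 + g22 * C212)" "d2g22 = 2 * (g12 * C122 + g22 * C222)"
      "d1g12 = g11 * C112 + g12 * C212 + g12 * C111 + g22 * C211"
      "d2g12 = g11 * C122 + g12 * C222 + g12 * C112 + g22 * C212"
    and v: "v1 = g11 * W1 + g12 * W2" "v2 = g12 * W1 + g22 * W2"
    and dv: "v11 = d1g11 * W1 + g11 * d1W1 + d1g12 * W2 + g12 * d1W2"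
      "v21 = d2g11 * W1 + g11 * d2W1 + d2g12 * W2 + g12 * d2W2"
      "v12 = d1g12 * W1 + g12 * d1W1 + d1g22 * W2 + g22 * d1W2"
      "v22 = d2g12 * W1 + g12 * d2W1 + d2g22 * W2 + g22 * d2W2"
    and sym: "v12 = v21"
  shows "g11 * (- d1g22 * W1 - g22 * d1W1 - (v22 - d2g12 * W1 - g12 * d2W1)
      + ((C111 + 2 * v1 - g11 * W1) * (C122 - g22 * W1) + (C112 + v2 - g12 * W1) * (C222 + 2 * v2 - g22 * W2)
        - (C112 + v2 - g12 * W1) * (C112 + v2 - g12 * W1) - (C122 - g22 * W1) * (C212 + v1 - g12 * W2))
      - (C111 * C122 + C112 * C222 - C112 * C112 - C122 * C212))
    + g12 * (2 * v12 - d1g22 * W2 - g22 * d1W2 - (v21 - d2g12 * W2 - g12 * d2W2)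
      + ((C211 - g11 * W2) * (C122 - g22 * W1) + (C212 + v1 - g12 * W2) * (C222 + 2 * v2 - g22 * W2)
        - (C212 + v1 - g12 * W2) * (C112 + v2 - g12 * W1) - (C222 + 2 * v2 - g22 * W2) * (C212 + v1 - g12 * W2))
      - (C211 * C122 + C212 * C222 - C212 * C112 - C222 * C212))
    = - ((g11 * g22 - g12\<^sup>2) * (d1W1 + d2W2)
      + ((d1g11 * g22 + g11 * d1g22 - 2 * g12 * d1g12) * W1
        + (d2g11 * g22 + g11 * d2g22 - 2 * g12 * d2g12) * W2) / 2)" (is "?l = ?r")
proof -
  \<comment> \<open>After the substitutions both sides are polynomials in the metric, the
    Christoffel symbols, the gradient and its derivatives. The sides of the goal differ exactly by
    the commutator of the mixed partials, which \<open>sym\<close> removes.\<close>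
  have "?l - ?r = g12 * (v12 - v21)"
    unfolding dv unfolding v unfolding metric by (simp only: power2_eq_square) algebra
  then show ?thesis using sym by simp
qed

lemmas Ck_on_1_intros = Ck_on_1_const Ck_on_1_add Ck_on_1_diff Ck_on_1_mult

lemma matrix_inv_2_mult:
  fixes A :: "real^2^2"
  assumes "det A \<noteq> 0" "A $ 2 $ 1 = A $ 1 $ 2"
  shows "matrix_inv A $ k $ 1 * A $ j $ 1 + matrix_inv A $ k $ 2 * A $ j $ 2 = (if k = j then 1 else 0)"
proof -
  have "det A = A$1$1 * A$2$2 - A$1$2 * A$1$2" using assms(2) by (simp add: det_2)
  then have "det A / det A = (A$1$1 * A$2$2 - A$1$2 * A$1$2) / det A" by simp
  then have 1: "A$1$1 * A$2$2 / det A - A$1$2 * A$1$2 / det A = 1"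
    using assms(1) by (simp add: diff_divide_distrib)
  have "\<forall>k j. matrix_inv A $ k $ 1 * A $ j $ 1 + matrix_inv A $ k $ 2 * A $ j $ 2 = (if k = j then 1 else 0)"
    unfolding forall_2 matrix_inv_2[OF assms(1)] assms(2) using 1 by (simp add: mult.commute)
  then show ?thesis by blast
qed

lemma det_2_scaleR: "det (e *\<^sub>R A :: real^2^2) = e\<^sup>2 * det A"
  by (simp add: det_2 power2_eq_square algebra_simps)

lemma matrix_inv_2_scaleR:
  fixes A :: "real^2^2"
  assumes "det A \<noteq> 0" "e \<noteq> 0"
  shows "matrix_inv (e *\<^sub>R A) $ k $ l = matrix_inv A $ k $ l / e"
proof -
  have "det (e *\<^sub>R A) \<noteq> 0" using assms by (simp add: det_2_scaleR)
  then have "\<forall>k l. matrix_inv (e *\<^sub>R A) $ k $ l = matrix_inv A $ k $ l / e"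
    unfolding forall_2 using assms by (simp add: matrix_inv_2 det_2_scaleR power2_eq_square)
  then show ?thesis by blast
qed

lemma matrix_inv_2_mult':
  fixes A :: "real^2^2"
  assumes "det A \<noteq> 0" "A $ 2 $ 1 = A $ 1 $ 2"
  shows "A $ 1 $ j * matrix_inv A $ 1 $ k + A $ 2 $ j * matrix_inv A $ 2 $ k = (if j = k then 1 else 0)"
proof -
  have "\<forall>j k. A $ 1 $ j * matrix_inv A $ 1 $ k + A $ 2 $ j * matrix_inv A $ 2 $ k
      = matrix_inv A $ k $ 1 * A $ j $ 1 + matrix_inv A $ k $ 2 * A $ j $ 2"
    unfolding forall_2 matrix_inv_2[OF assms(1)] assms(2) by (simp add: mult.commute)
  then show ?thesis using matrix_inv_2_mult[OF assms] by auto
qed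

text \<open>A metric in coordinates; positive definiteness is encoded by its leading minors.\<close>

locale metric_patch =
  fixes V :: "(real^2) set" and G :: "real^2 \<Rightarrow> real^2^2"
  assumes V: "open V" and G: "Ck_on 2 V G"
    and sym: "\<And>x. x \<in> V \<Longrightarrow> G x $ 2 $ 1 = G x $ 1 $ 2"
    and pos: "\<And>x. x \<in> V \<Longrightarrow> 0 < G x $ 1 $ 1" "\<And>x. x \<in> V \<Longrightarrow> 0 < det (G x)"
begin

abbreviation g where "g i j \<equiv> \<lambda>y. G y $ i $ j"
abbreviation inv_g where "inv_g i j \<equiv> \<lambda>y. matrix_inv (G y) $ i $ j"
abbreviation \<Gamma> where "\<Gamma> \<equiv> christoffel G"

lemma C2_g: "Ck_on 2 V (g i j)"
  using Ck_on_bounded_linear[OF V _ G, of "\<lambda>A. A $ i $ j"]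
  by (simp add: bounded_linear_compose[OF bounded_linear_vec_nth bounded_linear_vec_nth])

lemma C1_g: "Ck_on 1 V (g i j)"
  using Ck_on_mono[of 1 V "g i j"] C2_g[of i j] by (simp add: numeral_2_eq_2)

lemma C1_dg: "Ck_on 1 V (partial k (g i j))"
  using C2_g[of i j] by (simp add: Ck_on_2)

lemma C1_det: "Ck_on 1 V (\<lambda>y. det (G y))"
  unfolding det_2 by (intro Ck_on_1_intros V C1_g)

lemma det_nz: "x \<in> V \<Longrightarrow> det (G x) \<noteq> 0"
  using pos(2) by force

lemma C1_inv_g: "Ck_on 1 V (inv_g k l)"
proof -
  have p: "Ck_on 1 V (\<lambda>y. g i j y * inverse (det (G y)))" for i j
    by (intro Ck_on_1_mult Ck_on_1_inverse V C1_det pos(2) C1_g)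
  then have n: "Ck_on 1 V (\<lambda>y. - g i j y * inverse (det (G y)))" for i j
    using Ck_on_1_mult[OF V Ck_on_1_const[OF V, of "-1"] p[of i j]] by simp
  have "\<forall>k l. Ck_on 1 V (inv_g k l)" unfolding forall_2
  proof (intro conjI)
    show "Ck_on 1 V (inv_g 1 1)" by (rule Ck_on_cong[OF V _ p[of 2 2]])
      (simp add: matrix_inv_2[OF det_nz] divide_inverse)
    show "Ck_on 1 V (inv_g 1 2)" by (rule Ck_on_cong[OF V _ n[of 1 2]])
      (simp add: matrix_inv_2[OF det_nz] divide_inverse)
    show "Ck_on 1 V (inv_g 2 1)" by (rule Ck_on_cong[OF V _ n[of 2 1]])
      (simp add: matrix_inv_2[OF det_nz] divide_inverse)
    show "Ck_on 1 V (inv_g 2 2)" by (rule Ck_on_cong[OF V _ p[of 1 1]])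
      (simp add: matrix_inv_2[OF det_nz] divide_inverse)
  qed
  then show ?thesis by blast
qed

lemma C1_\<Gamma>: "Ck_on 1 V (\<Gamma> k i j)"
  unfolding christoffel_def[abs_def] sum_2 by (intro Ck_on_1_intros V C1_inv_g C1_dg)

lemma dg_sym: "x \<in> V \<Longrightarrow> partial k (g 2 1) x = partial k (g 1 2) x"
  by (rule partial_cong[OF V]) (auto simp: sym)

lemma g_inv_g:
  "x \<in> V \<Longrightarrow> g 1 j x * inv_g 1 k x + g 2 j x * inv_g 2 k x = (if j = k then 1 else 0)"
  by (rule matrix_inv_2_mult'[OF det_nz sym])

lemma lower_index:
  assumes x: "x \<in> V"
  shows "g 1 j x * (inv_g 1 1 x * a + inv_g 1 2 x * b) + g 2 j x * (inv_g 2 1 x * a + inv_g 2 2 x * b)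
    = (if j = 1 then a else b)"
proof -
  have "g 1 j x * (inv_g 1 1 x * a + inv_g 1 2 x * b) + g 2 j x * (inv_g 2 1 x * a + inv_g 2 2 x * b)
    = (g 1 j x * inv_g 1 1 x + g 2 j x * inv_g 2 1 x) * a + (g 1 j x * inv_g 1 2 x + g 2 j x * inv_g 2 2 x) * b"
    by (simp add: algebra_simps)
  then show ?thesis using exhaust_2[of j] by (auto simp: g_inv_g[OF x])
qed

lemma \<Gamma>_sym: "x \<in> V \<Longrightarrow> \<Gamma> k 2 1 x = \<Gamma> k 1 2 x"
  by (simp add: christoffel_def sum_2 dg_sym algebra_simps)

text \<open>These are the Christoffel symbols of the first kind. Solved for the derivatives of the
  metric they express metric compatibility, which is what the curvature identity takes as
  input.\<close>

lemma \<Gamma>_lowered: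
  assumes x: "x \<in> V"
  shows "g 1 m x * \<Gamma> 1 i j x + g 2 m x * \<Gamma> 2 i j x
    = (partial i (g j m) x + partial j (g i m) x - partial m (g i j) x) / 2"
proof -
  define T where "T l = partial i (g j l) x + partial j (g i l) x - partial l (g i j) x" for l
  have "\<Gamma> k i j x = inv_g k 1 x * (T 1 / 2) + inv_g k 2 x * (T 2 / 2)" for k
    by (simp add: christoffel_def sum_2 T_def add_divide_distrib)
  then show ?thesis using lower_index[OF x, of m "T 1 / 2" "T 2 / 2"] exhaust_2[of m]
    by (auto simp: T_def)
qed

definition s where "s y = sqrt (det (G y))"
text \<open>\<open>a\<close>, \<open>b\<close>, \<open>c\<close> are the entries of the inverse
  metric times the area density \<open>s\<close>, so \<open>div_grad a b c\<close> is
  \<open>s\<close> times the Laplace-Beltrami operator. The sign in \<open>b\<close> is a constant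
  factor so that the product rule covers it.\<close>

definition a where "a y = g 2 2 y * inverse (s y)"
definition b where "b y = - 1 * g 1 2 y * inverse (s y)"
definition c where "c y = g 1 1 y * inverse (s y)"

lemma s_pos: "x \<in> V \<Longrightarrow> 0 < s x"
  using pos(2) by (simp add: s_def)

lemma s_square: "x \<in> V \<Longrightarrow> s x * s x = g 1 1 x * g 2 2 x - g 1 2 x * g 1 2 x"
  using pos(2)[of x] sym[of x] by (simp add: s_def det_2)

lemma C1_s: "Ck_on 1 V s"
  unfolding s_def[abs_def] by (intro Ck_on_1_sqrt V C1_det pos)

lemma C1_coeff: "Ck_on 1 V a" "Ck_on 1 V b" "Ck_on 1 V c"
  unfolding a_def[abs_def] b_def[abs_def] c_def[abs_def]
  by (intro Ck_on_1_intros Ck_on_1_inverse V C1_g C1_s s_pos; assumption)+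

lemma coeff_pos: "x \<in> V \<Longrightarrow> 0 < c x" "x \<in> V \<Longrightarrow> 0 < a x"
proof -
  assume x: "x \<in> V"
  then show "0 < c x" using pos(1) s_pos by (simp add: c_def)
  have "0 < s x * s x" using s_pos[OF x] by simp
  then have "0 < g 1 1 x * g 2 2 x" using zero_le_square[of "g 1 2 x"] unfolding s_square[OF x] by linarith
  then have "0 < g 2 2 x" using pos(1)[OF x] by (simp add: zero_less_mult_iff)
  then show "0 < a x" using s_pos[OF x] by (simp add: a_def)
qed

text \<open>Peculiar to dimension two: scaling the inverse metric by the area density multiplies its
  determinant by \<open>det (G x)\<close>. This supplies the normalisation assumed by
  \<open>test_function\<close>.\<close>

lemma coeff_det: "x \<in> V \<Longrightarrow> a x * c x - (b x)\<^sup>2 = 1"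
proof -
  assume x: "x \<in> V"
  have "a x * c x - (b x)\<^sup>2 = (g 1 1 x * g 2 2 x - g 1 2 x * g 1 2 x) * (inverse (s x) * inverse (s x))"
    by (simp add: a_def b_def c_def power2_eq_square algebra_simps)
  also have "\<dots> = 1" unfolding s_square[OF x, symmetric] using s_pos[OF x] by (simp add: field_simps)
  finally show ?thesis .
qed

end

locale conformal_patch = metric_patch +
  fixes v :: "real^2 \<Rightarrow> real"
  assumes v: "Ck_on 2 V v"
begin

abbreviation G' where "G' \<equiv> \<lambda>y. exp (2 * v y) *\<^sub>R G y"
abbreviation \<Gamma>' where "\<Gamma>' \<equiv> christoffel G'"

text \<open>The gradient of \<open>v\<close> with raised index. Differentiating \<open>dv_eq\<close>
  rather than this formula keeps derivatives of the inverse metric out of the curvature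
  computation.\<close>

definition W where "W k y = inv_g k 1 y * partial 1 v y + inv_g k 2 y * partial 2 v y"

lemma C1_v: "Ck_on 1 V v"
  using Ck_on_mono[of 1 V v] v by (simp add: numeral_2_eq_2)

lemma C1_dv: "Ck_on 1 V (partial i v)"
  using v by (simp add: Ck_on_2)

lemma C1_W: "Ck_on 1 V (W k)"
  unfolding W_def[abs_def] by (intro Ck_on_1_intros V C1_inv_g C1_dv)

lemma dv_eq: "x \<in> V \<Longrightarrow> partial j v x = g 1 j x * W 1 x + g 2 j x * W 2 x"
  unfolding W_def lower_index using exhaust_2[of j] by auto

lemma C1_exp: "Ck_on 1 V (\<lambda>y. exp (2 * v y))"
  by (rule Ck_on_1_compose[OF V C1_v, of UNIV _ "\<lambda>t. 2 * exp (2 * t)"])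
    (auto intro!: derivative_eq_intros continuous_intros)

lemma has_partial_exp:
  "x \<in> V \<Longrightarrow> has_partial k (\<lambda>y. exp (2 * v y)) (2 * exp (2 * v x) * partial k v x) x"
  by (rule has_partial_chain[OF Ck_on_1_has_partial[OF C1_v], where \<phi> = "\<lambda>t. exp (2 * t)"])
    (auto intro!: derivative_eq_intros)

lemma partial_G':
  assumes x: "x \<in> V"
  shows "partial k (\<lambda>y. G' y $ i $ j) x = exp (2 * v x) * (2 * partial k v x * g i j x + partial k (g i j) x)"
proof -
  have "partial k (\<lambda>y. exp (2 * v y) * g i j y) x
      = 2 * exp (2 * v x) * partial k v x * g i j x + exp (2 * v x) * partial k (g i j) x"
    by (intro partial_eqI has_partial_mult has_partial_exp x Ck_on_1_has_partial[OF C1_g]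
        differentiable_mult Ck_on_1_D(1)[OF C1_exp] Ck_on_1_D(1)[OF C1_g])
  then show ?thesis by (simp add: algebra_simps)
qed

text \<open>The conformal factor cancels between the inverse metric and the differentiated metric,
  so only the derivatives of \<open>v\<close> remain.\<close>

lemma conformal_christoffel:
  assumes x: "x \<in> V"
  shows "\<Gamma>' k i j x = \<Gamma> k i j x + (if k = j then partial i v x else 0)
    + (if k = i then partial j v x else 0) - g i j x * W k x"
proof -
  define e where "e = exp (2 * v x)"
  have e: "e > 0" by (simp add: e_def)
  have "\<Gamma>' k i j x = (\<Sum>l\<in>UNIV. inv_g k l x / e * (e * (2 * partial i v x * g j l x + partial i (g j l) x)
      + e * (2 * partial j v x * g i l x + partial j (g i l) x)
      - e * (2 * partial l v x * g i j x + partial l (g i j) x))) / 2"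
    unfolding christoffel_def partial_G'[OF x] e_def
    by (subst matrix_inv_2_scaleR[OF det_nz[OF x]]) simp_all
  also have "\<dots> = (\<Sum>l\<in>UNIV. inv_g k l x * (partial i (g j l) x + partial j (g i l) x - partial l (g i j) x)) / 2
      + partial i v x * (inv_g k 1 x * g j 1 x + inv_g k 2 x * g j 2 x)
      + partial j v x * (inv_g k 1 x * g i 1 x + inv_g k 2 x * g i 2 x) - g i j x * W k x"
    using e by (simp add: sum_2 W_def field_simps)
  finally show ?thesis
    unfolding matrix_inv_2_mult[OF det_nz[OF x] sym[OF x]] christoffel_def by simp
qed

lemma C1_\<Gamma>': "Ck_on 1 V (\<Gamma>' k i j)"
proof (rule Ck_on_cong[OF V conformal_christoffel[symmetric]])
  have "Ck_on 1 V (\<lambda>y. if P then partial i v y else 0)" for P i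
    using C1_dv Ck_on_1_const[OF V] by (cases P) simp_all
  then show "Ck_on 1 V (\<lambda>y. \<Gamma> k i j y + (if k = j then partial i v y else 0)
      + (if k = i then partial j v y else 0) - g i j y * W k y)"
    by (intro Ck_on_1_intros V C1_\<Gamma> C1_g C1_W)
qed

lemma partial_\<Gamma>':
  assumes x: "x \<in> V"
  shows "partial m (\<Gamma>' k i j) x = partial m (\<Gamma> k i j) x
    + (if k = j then partial m (partial i v) x else 0) + (if k = i then partial m (partial j v) x else 0)
    - (partial m (g i j) x * W k x + g i j x * partial m (W k) x)"
proof (rule has_partial_unique)
  show "has_partial m (\<Gamma>' k i j) (partial m (\<Gamma>' k i j) x) x"
    by (rule Ck_on_1_has_partial[OF C1_\<Gamma>' x])
  have if_partial: "has_partial m (\<lambda>y. if P then f y else 0) (if P then d else 0) x"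
    if "has_partial m f d x" for P f d
    using that by (auto intro: has_partial_const)
  show "has_partial m (\<Gamma>' k i j) (partial m (\<Gamma> k i j) x
    + (if k = j then partial m (partial i v) x else 0) + (if k = i then partial m (partial j v) x else 0)
    - (partial m (g i j) x * W k x + g i j x * partial m (W k) x)) x"
    by (rule has_partial_cong[OF V x conformal_christoffel[symmetric]], assumption)
      (intro has_partial_add has_partial_diff has_partial_mult if_partial x
        Ck_on_1_has_partial[OF C1_\<Gamma>] Ck_on_1_has_partial[OF C1_dv] Ck_on_1_has_partial[OF C1_g]
        Ck_on_1_has_partial[OF C1_W])
qed

lemma partial_dv:
  assumes x: "x \<in> V"
  shows "partial i (partial j v) x = partial i (g 1 j) x * W 1 x + g 1 j x * partial i (W 1) x
    + (partial i (g 2 j) x * W 2 x + g 2 j x * partial i (W 2) x)"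
proof (rule has_partial_unique)
  show "has_partial i (partial j v) (partial i (partial j v) x) x"
    by (rule Ck_on_1_has_partial[OF C1_dv x])
  show "has_partial i (partial j v) (partial i (g 1 j) x * W 1 x + g 1 j x * partial i (W 1) x
    + (partial i (g 2 j) x * W 2 x + g 2 j x * partial i (W 2) x)) x"
    by (rule has_partial_cong[OF V x dv_eq[symmetric]], assumption)
      (intro has_partial_add has_partial_mult x Ck_on_1_has_partial[OF C1_g] Ck_on_1_has_partial[OF C1_W])
qed

lemma partial_det:
  assumes x: "x \<in> V"
  shows "partial k (\<lambda>y. det (G y)) x
    = partial k (g 1 1) x * g 2 2 x + g 1 1 x * partial k (g 2 2) x - 2 * g 1 2 x * partial k (g 1 2) x"
proof -
  have "has_partial k (\<lambda>y. det (G y)) (partial k (g 1 1) x * g 2 2 x + g 1 1 x * partial k (g 2 2) x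
    - (partial k (g 1 2) x * g 2 1 x + g 1 2 x * partial k (g 2 1) x)) x"
    unfolding det_2 by (intro has_partial_diff has_partial_mult x Ck_on_1_has_partial[OF C1_g])
  then show ?thesis
    using partial_eqI[OF Ck_on_1_D(1)[OF C1_det x]] by (simp add: sym[OF x] dg_sym[OF x])
qed

text \<open>\<open>det G\<close> times the Laplacian of \<open>v\<close>.\<close>

definition Lap :: "real^2 \<Rightarrow> real" where
  "Lap x = det (G x) * (partial 1 (W 1) x + partial 2 (W 2) x)
    + (partial 1 (\<lambda>y. det (G y)) x * W 1 x + partial 2 (\<lambda>y. det (G y)) x * W 2 x) / 2"

text \<open>The numerator of K' = e^(-2v) (K - Laplacian of v). The index is lowered with the
  original metric on both sides, which removes the exponentials from the identity.\<close>

lemma conformal_riemann: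
  assumes x: "x \<in> V"
  shows "(\<Sum>l\<in>UNIV. g 1 l x * riemann G' l 1 2 2 x) = (\<Sum>l\<in>UNIV. g 1 l x * riemann G l 1 2 2 x) - Lap x"
proof -
  have low: "partial i (g j m) x + partial j (g i m) x - partial m (g i j) x
      = 2 * (g 1 m x * \<Gamma> 1 i j x + g 2 m x * \<Gamma> 2 i j x)" for i j m
    using \<Gamma>_lowered[OF x, of m i j] by simp
  note s = sym[OF x] dg_sym[OF x] \<Gamma>_sym[OF x]
  have metric: "partial 1 (g 1 1) x = 2 * (g 1 1 x * \<Gamma> 1 1 1 x + g 1 2 x * \<Gamma> 2 1 1 x)"
    "partial 2 (g 1 1) x = 2 * (g 1 1 x * \<Gamma> 1 1 2 x + g 1 2 x * \<Gamma> 2 1 2 x)"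
    "partial 1 (g 2 2) x = 2 * (g 1 2 x * \<Gamma> 1 1 2 x + g 2 2 x * \<Gamma> 2 1 2 x)"
    "partial 2 (g 2 2) x = 2 * (g 1 2 x * \<Gamma> 1 2 2 x + g 2 2 x * \<Gamma> 2 2 2 x)"
    "partial 1 (g 1 2) x = g 1 1 x * \<Gamma> 1 1 2 x + g 1 2 x * \<Gamma> 2 1 2 x + g 1 2 x * \<Gamma> 1 1 1 x + g 2 2 x * \<Gamma> 2 1 1 x"
    "partial 2 (g 1 2) x = g 1 1 x * \<Gamma> 1 2 2 x + g 1 2 x * \<Gamma> 2 2 2 x + g 1 2 x * \<Gamma> 1 1 2 x + g 2 2 x * \<Gamma> 2 1 2 x"
    using low[of 1 1 1] low[of 1 2 1] low[of 1 2 2] low[of 2 2 2] low[of 1 1 2] low[of 2 2 1]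
    unfolding s by (simp_all add: algebra_simps)
  note id = conformal_curvature_identity[OF metric dv_eq[OF x, of 1, unfolded s] dv_eq[OF x, of 2]
      partial_dv[OF x, of 1 1, unfolded s add.assoc[symmetric]] partial_dv[OF x, of 2 1, unfolded s add.assoc[symmetric]]
      partial_dv[OF x, of 1 2, unfolded add.assoc[symmetric]] partial_dv[OF x, of 2 2, unfolded add.assoc[symmetric]]
      partial_commute[OF v V x, of 1 2]]
  have det: "det (G x) = g 1 1 x * g 2 2 x - (g 1 2 x)\<^sup>2" by (simp add: det_2 s power2_eq_square)
  have "(\<Sum>l\<in>UNIV. g 1 l x * riemann G' l 1 2 2 x) - (\<Sum>l\<in>UNIV. g 1 l x * riemann G l 1 2 2 x) = - Lap x"
    unfolding Lap_def partial_det[OF x] det id[symmetric] riemann_def sum_2 partial_\<Gamma>'[OF x]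
      conformal_christoffel[OF x] s
    by (simp add: algebra_simps)
  then show ?thesis by simp
qed

text \<open>The flux of \<open>v\<close> is \<open>s\<close> times its gradient \<open>W\<close>;
  since \<open>s\<close> is the square root of the determinant, differentiating it produces the
  factor 1/2 in \<open>Lap\<close>.\<close>

lemma div_grad_v:
  assumes x: "x \<in> V"
  shows "div_grad a b c v x = Lap x / s x"
proof -
  have flux: "a y * partial 1 v y + b y * partial 2 v y = s y * W 1 y"
    "b y * partial 1 v y + c y * partial 2 v y = s y * W 2 y" if y: "y \<in> V" for y
  proof -
    have "inverse (det (G y)) = inverse (s y) * inverse (s y)" using pos(2)[OF y]
      by (simp add: s_def flip: inverse_mult_distrib)
    moreover have "s y * inverse (s y) = 1" using s_pos[OF y] by simp
    ultimately show "a y * partial 1 v y + b y * partial 2 v y = s y * W 1 y"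
      "b y * partial 1 v y + c y * partial 2 v y = s y * W 2 y"
      unfolding W_def matrix_inv_2[OF det_nz[OF y]] sym[OF y] divide_inverse a_def b_def c_def
      by algebra+
  qed
  have s: "has_partial k s (inverse (s x) / 2 * partial k (\<lambda>y. det (G y)) x) x" for k
    unfolding s_def[abs_def]
    by (rule has_partial_chain[OF Ck_on_1_has_partial[OF C1_det x]])
      (use pos(2)[OF x] in \<open>auto intro!: derivative_eq_intros\<close>)
  have sW: "partial k (\<lambda>y. s y * W m y) x
      = inverse (s x) / 2 * partial k (\<lambda>y. det (G y)) x * W m x + s x * partial k (W m) x" for k m
    by (intro partial_eqI has_partial_mult s x Ck_on_1_has_partial[OF C1_W]
        differentiable_mult Ck_on_1_D(1)[OF C1_s] Ck_on_1_D(1)[OF C1_W])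
  have "det (G x) = s x * s x" using pos(2)[OF x] by (simp add: s_def)
  moreover have "partial 1 (\<lambda>y. a y * partial 1 v y + b y * partial 2 v y) x = partial 1 (\<lambda>y. s y * W 1 y) x"
    "partial 2 (\<lambda>y. b y * partial 1 v y + c y * partial 2 v y) x = partial 2 (\<lambda>y. s y * W 2 y) x"
    by (rule partial_cong[OF V x flux(1)], assumption) (rule partial_cong[OF V x flux(2)], assumption)
  moreover have "s x * inverse (s x) = 1" using s_pos[OF x] by simp
  ultimately show ?thesis
    unfolding div_grad_def sW Lap_def divide_inverse[of _ "s x"] by algebra
qed

lemma partial_exp: "x \<in> V \<Longrightarrow> partial i (\<lambda>y. exp (2 * v y)) x = 2 * exp (2 * v x) * partial i v x"
  by (intro partial_eqI has_partial_exp Ck_on_1_D(1)[OF C1_exp])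

lemma C1_partial_exp: "Ck_on 1 V (partial i (\<lambda>y. exp (2 * v y)))"
  by (rule Ck_on_cong[OF V partial_exp[symmetric]], assumption) (intro Ck_on_1_intros V C1_exp C1_dv)

lemma C2_exp: "Ck_on 2 V (\<lambda>y. exp (2 * v y))"
  unfolding Ck_on_2 using Ck_on_1_D(1)[OF C1_exp] C1_partial_exp by blast

lemma partial_partial_exp:
  assumes x: "x \<in> V"
  shows "partial j (partial i (\<lambda>y. exp (2 * v y))) x
    = 2 * (2 * exp (2 * v x) * partial j v x * partial i v x + exp (2 * v x) * partial j (partial i v) x)"
proof (rule has_partial_unique)
  show "has_partial j (partial i (\<lambda>y. exp (2 * v y))) (partial j (partial i (\<lambda>y. exp (2 * v y))) x) x"
    by (rule Ck_on_1_has_partial[OF C1_partial_exp x])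
  have "has_partial j (\<lambda>y. 2 * (exp (2 * v y) * partial i v y))
    (0 * (exp (2 * v x) * partial i v x)
      + 2 * (2 * exp (2 * v x) * partial j v x * partial i v x + exp (2 * v x) * partial j (partial i v) x)) x"
    by (intro has_partial_mult has_partial_const has_partial_exp x Ck_on_1_has_partial[OF C1_dv])
  then have "has_partial j (partial i (\<lambda>y. exp (2 * v y)))
    (0 * (exp (2 * v x) * partial i v x)
      + 2 * (2 * exp (2 * v x) * partial j v x * partial i v x + exp (2 * v x) * partial j (partial i v) x)) x"
    by (rule has_partial_cong[OF V x, rotated]) (simp add: partial_exp)
  then show "has_partial j (partial i (\<lambda>y. exp (2 * v y)))
    (2 * (2 * exp (2 * v x) * partial j v x * partial i v x + exp (2 * v x) * partial j (partial i v) x)) x"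
    by simp
qed

text \<open>Convexity of the exponential: by the chain rule the two sides differ by four times
  \<open>exp (2 * v x)\<close> times the coefficient form evaluated at the gradient of
  \<open>v\<close>.\<close>

lemma div_grad_exp:
  assumes x: "x \<in> V"
  shows "2 * exp (2 * v x) * div_grad a b c v x \<le> div_grad a b c (\<lambda>y. exp (2 * v y)) x"
proof -
  define p q where "p = partial 1 v x" and "q = partial 2 v x"
  have "div_grad a b c (\<lambda>y. exp (2 * v y)) x - 2 * exp (2 * v x) * div_grad a b c v x
      = 4 * exp (2 * v x) * (a x * p\<^sup>2 + 2 * b x * p * q + c x * q\<^sup>2)"
    unfolding div_grad_eq[OF C1_coeff v x] div_grad_eq[OF C1_coeff C2_exp x] partial_exp[OF x]
      partial_partial_exp[OF x] p_def q_def
    by (simp add: power2_eq_square algebra_simps)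
  moreover have "0 \<le> a x * p\<^sup>2 + 2 * b x * p * q + c x * q\<^sup>2"
  proof -
    \<comment> \<open>Multiplying by \<open>a x > 0\<close> completes the square; what is left is
      the determinant, equal to 1.\<close>
    have "a x * (a x * p\<^sup>2 + 2 * b x * p * q + c x * q\<^sup>2)
        = (a x * p + b x * q)\<^sup>2 + (a x * c x - (b x)\<^sup>2) * q\<^sup>2"
      by (simp add: power2_eq_square algebra_simps)
    then have "0 \<le> a x * (a x * p\<^sup>2 + 2 * b x * p * q + c x * q\<^sup>2)"
      by (simp add: coeff_det[OF x])
    then show ?thesis using coeff_pos(2)[OF x] by (simp add: zero_le_mult_iff)
  qed
  then have "0 \<le> 4 * exp (2 * v x) * (a x * p\<^sup>2 + 2 * b x * p * q + c x * q\<^sup>2)"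
    by (intro mult_nonneg_nonneg) auto
  ultimately show ?thesis by linarith
qed

lemma exp_subsolution:
  assumes x: "x \<in> V"
    and curv: "(\<Sum>l\<in>UNIV. G x $ 1 $ l * riemann G l 1 2 2 x) / det (G x) = -1"
    and curv': "(\<Sum>l\<in>UNIV. G' x $ 1 $ l * riemann G' l 1 2 2 x) / det (G' x) \<le> 0"
  shows "- (2 * s x) * exp (2 * v x) \<le> div_grad a b c (\<lambda>y. exp (2 * v y)) x"
proof -
  have det': "0 < det (G' x)" using pos(2)[OF x] by (simp add: det_2_scaleR)
  have "(\<Sum>l\<in>UNIV. G' x $ 1 $ l * riemann G' l 1 2 2 x)
      = exp (2 * v x) * (\<Sum>l\<in>UNIV. g 1 l x * riemann G' l 1 2 2 x)"
    by (simp add: sum_distrib_left mult.assoc)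
  then have "exp (2 * v x) * (\<Sum>l\<in>UNIV. g 1 l x * riemann G' l 1 2 2 x) \<le> 0"
    using curv' det' by (simp add: divide_le_0_iff)
  then have "(\<Sum>l\<in>UNIV. g 1 l x * riemann G' l 1 2 2 x) \<le> 0" by (simp add: mult_le_0_iff)
  moreover have "(\<Sum>l\<in>UNIV. g 1 l x * riemann G l 1 2 2 x) = - det (G x)"
    using curv det_nz[OF x] by (simp add: field_simps)
  moreover have "det (G x) = s x * s x" using pos(2)[OF x] by (simp add: s_def)
  ultimately have "- (s x * s x) \<le> Lap x" unfolding conformal_riemann[OF x] by simp
  then have "- s x \<le> div_grad a b c v x"
    unfolding div_grad_v[OF x] using s_pos[OF x] by (simp add: field_simps)
  then have "2 * exp (2 * v x) * (- s x) \<le> 2 * exp (2 * v x) * div_grad a b c v x"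
    by (intro mult_left_mono) auto
  then show ?thesis using div_grad_exp[OF x] by (simp add: algebra_simps)
qed

end

section \<open>The global bound\<close>

text \<open>The constants are obtained before \<open>v\<close> and \<open>x\<close> are quantified,
  so they are uniform in both. The integral on the right is the area of a coordinate disc in the
  conformal metric.\<close>

lemma (in metric_patch) local_bound:
  assumes p: "p \<in> V"
    and curv: "\<And>x. x \<in> V \<Longrightarrow> (\<Sum>l\<in>UNIV. G x $ 1 $ l * riemann G l 1 2 2 x) / det (G x) = -1"
  obtains C \<rho> r where "0 \<le> C" "0 < \<rho>" "\<And>x. x \<in> ball p \<rho> \<Longrightarrow> ball x r \<subseteq> V"
    "\<And>v x. Ck_on 2 V v \<Longrightarrow>
      (\<And>y. y \<in> V \<Longrightarrow> (\<Sum>l\<in>UNIV. (exp (2 * v y) *\<^sub>R G y) $ 1 $ l *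
        riemann (\<lambda>y. exp (2 * v y) *\<^sub>R G y) l 1 2 2 y) / det (exp (2 * v y) *\<^sub>R G y) \<le> 0) \<Longrightarrow>
      x \<in> ball p \<rho> \<Longrightarrow> (\<And>y. y \<in> V \<Longrightarrow> v y \<le> v x) \<Longrightarrow>
      ennreal (exp (2 * v x)) \<le> ennreal C *
        (\<integral>\<^sup>+y. ennreal (sqrt (det (exp (2 * v y) *\<^sub>R G y))) * indicator (ball x r) y \<partial>lborel)"
proof -
  obtain R where R: "0 < R" "cball p R \<subseteq> V" using V p unfolding open_contains_cball by auto
  \<comment> \<open>Every quantity that must be bounded is a summand here, so one bound
    \<open>B\<close> on a compact disc serves for all of them; the final 1 ensures
    \<open>1 \<le> B\<close>.\<close>
  define \<Psi> where "\<Psi> x = \<bar>a x\<bar> + \<bar>b x\<bar> + \<bar>c x\<bar>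
    + (\<Sum>i\<in>UNIV. \<bar>partial i a x\<bar> + \<bar>partial i b x\<bar> + \<bar>partial i c x\<bar>) + 2 * s x + inverse (s x) + 1" for x
  have cont_s: "continuous_on V s" by (rule Ck_on_1_continuous[OF C1_s])
  have "\<forall>x\<in>V. s x \<noteq> 0" using s_pos by fastforce
  with cont_s have inv_s: "continuous_on V (\<lambda>x. inverse (s x))" by (rule continuous_on_inverse)
  have "continuous_on V \<Psi>"
    unfolding \<Psi>_def[abs_def]
    by (intro continuous_on_add continuous_on_mult continuous_on_const continuous_on_rabs continuous_on_sum
        C1_coeff[THEN Ck_on_1_continuous] C1_coeff[THEN Ck_on_1_D(2)] cont_s inv_s)
  then have "compact (\<Psi> ` cball p R)"
    by (rule compact_continuous_image[OF continuous_on_subset[OF _ R(2)] compact_cball])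
  then obtain B where \<Psi>: "\<And>x. x \<in> cball p R \<Longrightarrow> \<Psi> x \<le> B"
    using bounded_imp_bdd_above[OF compact_imp_bounded, of "\<Psi> ` cball p R"]
    unfolding bdd_above_def by blast
  have bounds: "\<bar>a x\<bar> \<le> B" "\<bar>b x\<bar> \<le> B" "\<bar>c x\<bar> \<le> B" "\<bar>partial i a x\<bar> \<le> B" "\<bar>partial i b x\<bar> \<le> B"
    "\<bar>partial i c x\<bar> \<le> B" "0 \<le> 2 * s x" "2 * s x \<le> B" "inverse (s x) \<le> B" "1 \<le> B"
    if "x \<in> cball p R" for x i
  proof -
    have sx: "0 < s x" "0 < inverse (s x)" using s_pos R that by auto
    define \<Sigma> where "\<Sigma> = (\<Sum>i\<in>UNIV. \<bar>partial i a x\<bar> + \<bar>partial i b x\<bar> + \<bar>partial i c x\<bar>)"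
    have *: "\<bar>partial i a x\<bar> + \<bar>partial i b x\<bar> + \<bar>partial i c x\<bar> \<le> \<Sigma>" for i
      unfolding \<Sigma>_def by (rule member_le_sum) auto
    have sum: "\<bar>a x\<bar> + \<bar>b x\<bar> + \<bar>c x\<bar> + \<Sigma> + 2 * s x + inverse (s x) + 1 \<le> B"
      using \<Psi>[OF that] by (simp add: \<Psi>_def \<Sigma>_def)
    have arith: "t1 \<le> B \<and> t2 \<le> B \<and> t3 \<le> B \<and> t4 \<le> B \<and> t5 \<le> B \<and> t6 \<le> B \<and> t7 \<le> B \<and> t8 \<le> B \<and> 1 \<le> B"
      if "0 \<le> t1" "0 \<le> t2" "0 \<le> t3" "0 \<le> t4" "0 \<le> t5" "0 \<le> t6" "0 < t7" "0 < t8"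
        "t4 + t5 + t6 \<le> \<Sigma>" "t1 + t2 + t3 + \<Sigma> + t7 + t8 + 1 \<le> B" for t1 t2 t3 t4 t5 t6 t7 t8 :: real
      using that by auto
    have "0 < 2 * s x" using sx by simp
    from arith[OF abs_ge_zero abs_ge_zero abs_ge_zero abs_ge_zero abs_ge_zero abs_ge_zero this sx(2) *[of i] sum]
    show "\<bar>a x\<bar> \<le> B" "\<bar>b x\<bar> \<le> B" "\<bar>c x\<bar> \<le> B" "\<bar>partial i a x\<bar> \<le> B" "\<bar>partial i b x\<bar> \<le> B"
      "\<bar>partial i c x\<bar> \<le> B" "0 \<le> 2 * s x" "2 * s x \<le> B" "inverse (s x) \<le> B" "1 \<le> B"
      using sx by simp_all
  qed
  have B: "1 \<le> B" using bounds(10)[of p] R by simp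
  \<comment> \<open>The first bound keeps discs of radius \<open>r\<close> about points of
    \<open>ball p (R / 2)\<close> within the compact disc; the second is the smallness required by
    \<open>max_le_integral\<close>.\<close>
  define r where "r = min (R / 2) (1 / (36992 * B ^ 6))"
  have r: "0 < r" "r \<le> R / 2" "r \<le> 1 / (36992 * B ^ 6)" using R B by (auto simp: r_def)
  have sub: "cball x r \<subseteq> cball p R" if "x \<in> ball p (R / 2)" for x
  proof
    fix y assume "y \<in> cball x r"
    then show "y \<in> cball p R" using that r dist_triangle[of p y x] by auto
  qed
  define K where "K = 768 * B\<^sup>2 / (pi * r\<^sup>2)"
  have K: "0 \<le> K" by (simp add: K_def)
  show thesis
  proof (rule that[of "K * B" "R / 2" r])
    show "0 \<le> K * B" "0 < R / 2" using K B R by auto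
    show "ball x r \<subseteq> V" if "x \<in> ball p (R / 2)" for x
      using sub[OF that] R ball_subset_cball[of x r] by blast
  next
    fix v x
    assume v: "Ck_on 2 V v" and max: "\<And>y. y \<in> V \<Longrightarrow> v y \<le> v x" and x: "x \<in> ball p (R / 2)"
      and curv': "\<And>y. y \<in> V \<Longrightarrow> (\<Sum>l\<in>UNIV. (exp (2 * v y) *\<^sub>R G y) $ 1 $ l *
        riemann (\<lambda>y. exp (2 * v y) *\<^sub>R G y) l 1 2 2 y) / det (exp (2 * v y) *\<^sub>R G y) \<le> 0"
    interpret conformal_patch V G v by unfold_locales (rule v)
    let ?f = "\<lambda>y. exp (2 * v y)" and ?I = "indicator (ball x r) :: real^2 \<Rightarrow> real"
    note xr = subsetD[OF sub[OF x]]
    have xR: "x \<in> cball p R" using xr[of x] r by simp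
    have inV: "y \<in> V" if "y \<in> cball x r" for y using xr[OF that] R by blast
    have ball: "y \<in> V" "y \<in> cball p R" if "y \<in> ball x r" for y
      using that inV[of y] xr[of y] by auto
    have xx: "x \<in> cball x r" using r by simp
    have w: "0 \<le> 2 * s y \<and> 2 * s y \<le> B" if "y \<in> cball x r" for y
      using bounds(7,8)[OF xr[OF that]] by blast
    have f: "0 \<le> ?f y \<and> ?f y \<le> ?f x" if "y \<in> cball x r" for y
      using max[OF inV[OF that]] by simp
    have subsol: "- (2 * s y) * ?f y \<le> div_grad a b c ?f y" if "y \<in> cball x r" for y
      by (rule exp_subsolution[OF inV[OF that] curv[OF inV[OF that]] curv'[OF inV[OF that]]])
    have cb: "cball x r \<subseteq> V" using inV by blast
    note max_int = max_le_integral[of B r V x a b c ?f "\<lambda>y. 2 * s y", OF B r(1,3) V cb C1_coeff C2_exp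
        coeff_det[OF inV[OF xx]] coeff_pos(2)[OF inV[OF xx]] bounds(1-3)[OF xR]
        bounds(4)[OF xr] bounds(5)[OF xr] bounds(6)[OF xr] w f subsol]
    have est: "?f x \<le> K * (\<integral>y. ?I y * ?f y \<partial>lborel)" and int: "integrable lborel (\<lambda>y. ?I y * ?f y)"
      unfolding K_def by (rule max_int; assumption)+
    show "ennreal (?f x) \<le> ennreal (K * B) *
        (\<integral>\<^sup>+y. ennreal (sqrt (det (?f y *\<^sub>R G y))) * indicator (ball x r) y \<partial>lborel)"
    proof -
      \<comment> \<open>In dimension two the area density scales by the conformal factor itself.
        Together with \<open>1 \<le> B * s y\<close>, this turns the integral of the factor into an
        area.\<close>
      have sqrt: "sqrt (det (?f y *\<^sub>R G y)) = ?f y * s y" for y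
        by (simp add: det_2_scaleR s_def real_sqrt_mult)
      have le: "?I y * ?f y \<le> B * (?I y * (?f y * s y))" for y
      proof (cases "y \<in> ball x r")
        case True
        have "inverse (s y) * s y \<le> B * s y"
          using bounds(9)[OF ball(2)[OF True]] s_pos[OF ball(1)[OF True]] by (intro mult_right_mono) auto
        then have "?f y * 1 \<le> ?f y * (B * s y)"
          using s_pos[OF ball(1)[OF True]] by (intro mult_left_mono) auto
        then show ?thesis using True by (simp add: mult_ac)
      qed simp
      have "continuous_on V (\<lambda>y. ?f y * s y)"
        by (rule continuous_on_mult[OF Ck_on_1_continuous[OF C1_exp] Ck_on_1_continuous[OF C1_s]])
      moreover have "ball x r \<subseteq> V" using ball(1) by blast
      ultimately have "continuous_on (ball x r) (\<lambda>y. ?f y * s y)" by (rule continuous_on_subset)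
      from borel_measurable_continuous_on_indicator[OF _ this]
      have meas: "(\<lambda>y. ?I y * (?f y * s y)) \<in> borel_measurable borel"
        by simp
      define Q where "Q = (\<integral>\<^sup>+y. ennreal (sqrt (det (?f y *\<^sub>R G y))) * indicator (ball x r) y \<partial>lborel)"
      have J: "(\<integral>\<^sup>+y. ennreal (?I y * ?f y) \<partial>lborel) = ennreal (\<integral>y. ?I y * ?f y \<partial>lborel)"
        by (rule nn_integral_eq_integral[OF int]) simp
      have "(\<integral>\<^sup>+y. ennreal (?I y * ?f y) \<partial>lborel) \<le> (\<integral>\<^sup>+y. ennreal B * ennreal (?I y * (?f y * s y)) \<partial>lborel)"
      proof (intro nn_integral_mono)
        fix y
        have "ennreal (?I y * ?f y) \<le> ennreal (B * (?I y * (?f y * s y)))" by (rule ennreal_leI[OF le])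
        also have "\<dots> = ennreal B * ennreal (?I y * (?f y * s y))"
          using B s_pos[OF ball(1), of y] by (intro ennreal_mult) (auto simp: indicator_def)
        finally show "ennreal (?I y * ?f y) \<le> ennreal B * ennreal (?I y * (?f y * s y))" .
      qed
      also have "\<dots> = ennreal B * (\<integral>\<^sup>+y. ennreal (?I y * (?f y * s y)) \<partial>lborel)"
        using meas by (intro nn_integral_cmult) simp
      also have "(\<integral>\<^sup>+y. ennreal (?I y * (?f y * s y)) \<partial>lborel) = Q"
        unfolding Q_def by (intro nn_integral_cong) (auto simp: sqrt indicator_def)
      finally have *: "ennreal (\<integral>y. ?I y * ?f y \<partial>lborel) \<le> ennreal B * Q" unfolding J .
      have "ennreal (?f x) \<le> ennreal (K * (\<integral>y. ?I y * ?f y \<partial>lborel))" using est by (rule ennreal_leI)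
      also have "\<dots> = ennreal K * ennreal (\<integral>y. ?I y * ?f y \<partial>lborel)" by (rule ennreal_mult'[OF K])
      also have "\<dots> \<le> ennreal K * (ennreal B * Q)" by (rule mult_left_mono[OF *]) simp
      also have "\<dots> = ennreal (K * B) * Q" by (simp add: ennreal_mult'[OF K] mult.assoc)
      finally show ?thesis unfolding Q_def .
    qed
  qed
qed

section \<open>Passage between charts and the surface\<close>

lemma smooth_on_Ck: "smooth_on U f \<Longrightarrow> Ck_on k U f"
  by (simp add: smooth_on_def)

lemma metric_patch_in_chart:
  assumes "is_chart M c" "c \<in> S" "riemannian_metric S \<sigma>"
  shows "metric_patch (image_of c) (in_chart c (\<sigma> c))"
proof
  let ?G = "in_chart c (\<sigma> c)"
  show "open (image_of c)" using assms(1) by (simp add: is_chart_def)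
  show "Ck_on 2 (image_of c) ?G"
    using assms(2,3) by (intro smooth_on_Ck) (auto simp: riemannian_metric_def)
  fix x assume x: "x \<in> image_of c"
  define p where "p = inv_into (dom_of c) (coord c) x"
  have p: "p \<in> dom_of c" unfolding p_def using x by (rule inv_into_into)
  have G: "?G x = \<sigma> c p" by (simp add: in_chart_def p_def)
  have sym: "transpose (?G x) = ?G x" and pos: "\<And>v. v \<noteq> 0 \<Longrightarrow> v \<bullet> (?G x *v v) > 0"
    using assms(2,3) p unfolding riemannian_metric_def G by blast+
  have "transpose (?G x) $ 2 $ 1 = ?G x $ 1 $ 2" by (simp add: transpose_def)
  then show s: "?G x $ 2 $ 1 = ?G x $ 1 $ 2" unfolding sym .
  have quad: "v \<bullet> (?G x *v v) = v$1 * (?G x $ 1 $ 1 * v$1 + ?G x $ 1 $ 2 * v$2)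
      + v$2 * (?G x $ 2 $ 1 * v$1 + ?G x $ 2 $ 2 * v$2)" for v
    by (simp add: inner_vec_def matrix_vector_mult_def sum_2)
  have "axis 1 1 \<noteq> (0 :: real^2)" by (simp add: axis_eq_0_iff)
  from pos[OF this] show E: "0 < ?G x $ 1 $ 1" unfolding quad by (simp add: axis_def)
  \<comment> \<open>This vector is orthogonal to the first basis vector with respect to the metric,
    so its squared length is the first minor times the determinant.\<close>
  define v :: "real^2" where "v = vector [- ?G x $ 1 $ 2, ?G x $ 1 $ 1]"
  have "v $ 2 \<noteq> 0" using E by (simp add: v_def)
  then have "v \<noteq> 0" by auto
  from pos[OF this] have "0 < ?G x $ 1 $ 1 * det (?G x)"
    unfolding quad by (simp add: v_def det_2 s algebra_simps)
  then show "0 < det (?G x)" using E by (simp add: zero_less_mult_iff)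
qed

lemma in_chart_conformal_metric:
  "in_chart c (conformal_metric u \<sigma> c) = (\<lambda>y. exp (2 * in_chart c u y) *\<^sub>R in_chart c (\<sigma> c) y)"
  by (simp add: in_chart_def conformal_metric_def fun_eq_iff)

lemma in_chart_coord: "is_chart M c \<Longrightarrow> p \<in> dom_of c \<Longrightarrow> in_chart c f (coord c p) = f p"
  by (auto simp: in_chart_def is_chart_def homeomorphism_def)

lemma openin_chart_preimage:
  assumes "is_chart M c" "open T"
  shows "openin (top_of_set M) {p \<in> dom_of c. coord c p \<in> T}"
proof -
  have "continuous_on (dom_of c) (coord c)" using assms(1) by (auto simp: is_chart_def homeomorphism_def)
  then have "openin (top_of_set (dom_of c)) (dom_of c \<inter> coord c -` T)"
    using assms(2) by (rule continuous_openin_preimage_gen)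
  moreover have "openin (top_of_set M) (dom_of c)" using assms(1) by (simp add: is_chart_def)
  ultimately have "openin (top_of_set M) (dom_of c \<inter> coord c -` T)" by (rule openin_trans)
  moreover have "dom_of c \<inter> coord c -` T = {p \<in> dom_of c. coord c p \<in> T}" by auto
  ultimately show ?thesis by simp
qed

text \<open>\<open>area\<close> is a supremum over finite families of pieces, and the part of the
  chart lying over \<open>T\<close> is a family with a single member.\<close>

lemma chart_area_le_area:
  assumes "c \<in> S" "is_chart M c" "open T" "T \<subseteq> image_of c"
  shows "(\<integral>\<^sup>+x. ennreal (sqrt (det (in_chart c (g c) x))) * indicator T x \<partial>lborel) \<le> area M S g M"
proof -
  define E where "E = {p \<in> dom_of c. coord c p \<in> T}"
  have "openin (top_of_set M) E" unfolding E_def by (rule openin_chart_preimage[OF assms(2,3)])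
  then obtain U where U: "open U" "E = M \<inter> U" by (auto simp: openin_open)
  then have meas: "E \<in> sets (restrict_space borel M)" by (auto simp: sets_restrict_space)
  have "coord c ` E = T" using assms(4) by (auto simp: E_def)
  then have "(\<integral>\<^sup>+x. ennreal (sqrt (det (in_chart c (g c) x))) * indicator T x \<partial>lborel)
      = (\<Sum>i<1::nat. chart_area g c E)" by (simp add: chart_area_def)
  also have "\<dots> \<le> area M S g M"
    unfolding area_def
  proof (rule Sup_upper, intro CollectI exI conjI)
    show "(\<Sum>i<1::nat. chart_area g c E) = (\<Sum>i<1::nat. chart_area g ((\<lambda>_. c) i) ((\<lambda>_. E) i))" by simp
    show "disjoint_family_on (\<lambda>_::nat. E) {..<1}" by (auto simp: disjoint_family_on_def)
    show "\<forall>i<1::nat. c \<in> S \<and> E \<in> sets (restrict_space borel M) \<and> E \<subseteq> M \<inter> dom_of c"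
      using assms(1) meas U by (auto simp: E_def)
  qed
  finally show ?thesis .
qed

lemma smooth_function_continuous_on:
  fixes M :: "'a::t2_space set"
  assumes "smooth_atlas M S" "smooth_function S u"
  shows "continuous_on M u"
  unfolding continuous_on_eq_continuous_within
proof
  fix p assume "p \<in> M"
  then obtain c where c: "c \<in> S" "p \<in> dom_of c" using assms(1) unfolding smooth_atlas_def by blast
  have ch: "is_chart M c" using assms(1) c by (simp add: smooth_atlas_def)
  have "continuous_on (image_of c) (in_chart c u)"
    using assms(2) c smooth_on_Ck[of _ _ 0] by (auto simp: smooth_function_def)
  moreover have "continuous_on (dom_of c) (coord c)" using ch by (auto simp: is_chart_def homeomorphism_def)
  ultimately have "continuous_on (dom_of c) (\<lambda>q. in_chart c u (coord c q))"
    by (rule continuous_on_compose2) auto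
  then have "continuous_on (dom_of c) u"
    by (rule continuous_on_eq) (simp add: in_chart_coord[OF ch])
  then have "continuous (at p within dom_of c) u" using c(2) by (simp add: continuous_on_eq_continuous_within)
  moreover obtain U where "open U" "dom_of c = M \<inter> U"
    using ch by (auto simp: is_chart_def openin_open)
  ultimately show "continuous (at p within M) u"
    using c(2) at_within_nhd[of p U "dom_of c" M] by (simp add: continuous_within Int_absorb Int_left_absorb Int_ac)
qed

theorem theorem1:
  fixes M :: "'a::t2_space set"
    and S :: "'a chart set"
    and \<sigma> :: "'a metric_field"
    and A :: real
  assumes "closed_surface M S"
    and "hyperbolic_metric S \<sigma>"
    and "genus M \<ge> 2"
    and "area M S \<sigma> M = ennreal A"
  shows "\<exists>C::real. C > 0 \<and>
    (\<forall>u :: 'a \<Rightarrow> real.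
       smooth_function S u \<and>
       riemannian_metric S (conformal_metric u \<sigma>) \<and>
       nonpositively_curved S (conformal_metric u \<sigma>) \<and>
       area M S (conformal_metric u \<sigma>) M = ennreal A
       \<longrightarrow> (\<forall>x\<in>M. u x \<le> C))"
proof -
  define admissible where "admissible u \<longleftrightarrow> smooth_function S u \<and>
      nonpositively_curved S (conformal_metric u \<sigma>) \<and> area M S (conformal_metric u \<sigma>) M = ennreal A" for u
  have M: "compact M" "smooth_atlas M S" using assms(1) by (auto simp: closed_surface_def)
  have chart: "is_chart M c" if "c \<in> S" for c using M(2) that by (simp add: smooth_atlas_def)
  have hyp: "riemannian_metric S \<sigma>" "\<And>c p. c \<in> S \<Longrightarrow> p \<in> dom_of c \<Longrightarrow> gauss_curvature \<sigma> c p = -1"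
    using assms(2) by (auto simp: hyperbolic_metric_def)
  \<comment> \<open>The local bound concerns only those \<open>x\<close> in \<open>N\<close> at
    which \<open>u\<close> is maximal over all of \<open>M\<close>; \<open>C\<close> depends on
    \<open>p\<close> but not on \<open>u\<close>.\<close>
  have "\<exists>N C. openin (top_of_set M) N \<and> p \<in> N \<and> 0 \<le> C \<and>
      (\<forall>u x. admissible u \<longrightarrow> x \<in> N \<longrightarrow> (\<forall>y\<in>M. u y \<le> u x) \<longrightarrow> u x \<le> C)" if pM: "p \<in> M" for p
  proof -
    obtain c where c: "c \<in> S" "p \<in> dom_of c" using M(2) pM unfolding smooth_atlas_def by blast
    note ch = chart[OF c(1)]
    let ?V = "image_of c" and ?G = "in_chart c (\<sigma> c)"
    interpret metric_patch ?V ?G by (rule metric_patch_in_chart[OF ch c(1) hyp(1)])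
    have curv: "(\<Sum>l\<in>UNIV. in_chart c (h c) x $ 1 $ l * riemann (in_chart c (h c)) l 1 2 2 x) / det (in_chart c (h c) x)
        = gauss_curvature h c (inv_into (dom_of c) (coord c) x)" if "x \<in> ?V" for h x
      using f_inv_into_f[OF that] by (simp add: gauss_curvature_def Let_def)
    have inv: "inv_into (dom_of c) (coord c) x \<in> dom_of c" if "x \<in> ?V" for x
      using that by (rule inv_into_into)
    have "coord c p \<in> ?V" using c by simp
    moreover have "(\<Sum>l\<in>UNIV. ?G x $ 1 $ l * riemann ?G l 1 2 2 x) / det (?G x) = -1" if "x \<in> ?V" for x
      unfolding curv[OF that] by (rule hyp(2)[OF c(1) inv[OF that]])
    ultimately show ?thesis
    proof (rule local_bound)
      fix C \<rho> r
      assume C: "0 \<le> C" and \<rho>: "0 < \<rho>"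
        and sub: "\<And>x. x \<in> ball (coord c p) \<rho> \<Longrightarrow> ball x r \<subseteq> ?V"
        and bound: "\<And>v x. Ck_on 2 ?V v \<Longrightarrow>
          (\<And>y. y \<in> ?V \<Longrightarrow> (\<Sum>l\<in>UNIV. (exp (2 * v y) *\<^sub>R ?G y) $ 1 $ l *
            riemann (\<lambda>y. exp (2 * v y) *\<^sub>R ?G y) l 1 2 2 y) / det (exp (2 * v y) *\<^sub>R ?G y) \<le> 0) \<Longrightarrow>
          x \<in> ball (coord c p) \<rho> \<Longrightarrow> (\<And>y. y \<in> ?V \<Longrightarrow> v y \<le> v x) \<Longrightarrow>
          ennreal (exp (2 * v x)) \<le> ennreal C *
            (\<integral>\<^sup>+y. ennreal (sqrt (det (exp (2 * v y) *\<^sub>R ?G y))) * indicator (ball x r) y \<partial>lborel)"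
      define N where "N = {q \<in> dom_of c. coord c q \<in> ball (coord c p) \<rho>}"
      have "u x \<le> C * max 0 A" if u: "admissible u" and x: "x \<in> N" and max: "\<forall>y\<in>M. u y \<le> u x" for u x
      proof -
        let ?u = "in_chart c u"
        note conf = in_chart_conformal_metric[of c u \<sigma>]
        have x': "x \<in> dom_of c" "coord c x \<in> ball (coord c p) \<rho>" using x by (auto simp: N_def)
        have "Ck_on 2 ?V ?u" using u c(1) by (intro smooth_on_Ck) (auto simp: admissible_def smooth_function_def)
        moreover have "(\<Sum>l\<in>UNIV. (exp (2 * ?u y) *\<^sub>R ?G y) $ 1 $ l *
            riemann (\<lambda>y. exp (2 * ?u y) *\<^sub>R ?G y) l 1 2 2 y) / det (exp (2 * ?u y) *\<^sub>R ?G y) \<le> 0" if "y \<in> ?V" for y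
          using curv[OF that, of "conformal_metric u \<sigma>"] u c(1) inv[OF that] unfolding conf
          by (simp add: admissible_def nonpositively_curved_def)
        moreover have "?u y \<le> ?u (coord c x)" if "y \<in> ?V" for y
        proof -
          have "dom_of c \<subseteq> M" using ch by (auto simp: is_chart_def dest: openin_imp_subset)
          then show ?thesis using max inv[OF that] unfolding in_chart_coord[OF ch x'(1)]
            by (auto simp: in_chart_def)
        qed
        ultimately have "ennreal (exp (2 * ?u (coord c x))) \<le> ennreal C *
            (\<integral>\<^sup>+y. ennreal (sqrt (det (exp (2 * ?u y) *\<^sub>R ?G y))) * indicator (ball (coord c x) r) y \<partial>lborel)"
          using x'(2) by (intro bound) auto
        also have "\<dots> \<le> ennreal C * area M S (conformal_metric u \<sigma>) M"
          using chart_area_le_area[OF c(1) ch open_ball sub[OF x'(2)], of "conformal_metric u \<sigma>"]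
          unfolding conf by (intro mult_left_mono) auto
        \<comment> \<open>\<open>ennreal\<close> sends negative reals to 0, so
          \<open>max 0 A\<close> represents the same area for every real \<open>A\<close>.\<close>
        also have "\<dots> = ennreal C * ennreal (max 0 A)"
          using u by (auto simp: admissible_def max_def ennreal_neg)
        also have "\<dots> = ennreal (C * max 0 A)" using C by (simp add: ennreal_mult)
        finally have "exp (2 * u x) \<le> C * max 0 A"
          unfolding in_chart_coord[OF ch x'(1)] using C by (subst (asm) ennreal_le_iff) auto
        \<comment> \<open>This cruder comparison replaces taking a logarithm of a bound that might
          be 0.\<close>
        moreover have "u x \<le> exp (2 * u x)"
        proof (cases "0 \<le> u x")
          case True
          then show ?thesis using exp_ge_add_one_self[of "2 * u x"] by linarith
        next
          case False
          then show ?thesis using exp_gt_zero[of "2 * u x"] by linarith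
        qed
        ultimately show ?thesis by linarith
      qed
      moreover have "openin (top_of_set M) N" unfolding N_def by (rule openin_chart_preimage[OF ch open_ball])
      moreover have "p \<in> N" using c \<rho> by (simp add: N_def)
      moreover have "0 \<le> C * max 0 A" using C by simp
      ultimately show ?thesis by blast
    qed
  qed
  then obtain N C where N: "\<And>p. p \<in> M \<Longrightarrow> openin (top_of_set M) (N p)" "\<And>p. p \<in> M \<Longrightarrow> p \<in> N p"
    and C0: "\<And>p. p \<in> M \<Longrightarrow> 0 \<le> C p"
    and C: "\<And>p u x. p \<in> M \<Longrightarrow> admissible u \<Longrightarrow> x \<in> N p \<Longrightarrow> (\<forall>y\<in>M. u y \<le> u x) \<Longrightarrow> u x \<le> C p"
    by metis
  have "M \<subseteq> \<Union>(N ` M)" using N(2) by auto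
  then obtain D where D: "D \<subseteq> N ` M" "finite D" "M \<subseteq> \<Union>D"
    using M(1) N(1) unfolding compact_eq_openin_cover by (metis (no_types, lifting) imageE)
  obtain F where F: "F \<subseteq> M" "finite F" "D = N ` F" using finite_subset_image[OF D(2,1)] by blast
  show ?thesis
  proof (intro exI conjI allI impI ballI)
    \<comment> \<open>The sum dominates each \<open>C p\<close> because all are nonnegative; the
      summand 1 makes the constant positive.\<close>
    show "0 < 1 + (\<Sum>p\<in>F. C p)" using C0 F by (intro add_pos_nonneg sum_nonneg) auto
    fix u x
    assume u: "smooth_function S u \<and> riemannian_metric S (conformal_metric u \<sigma>) \<and>
       nonpositively_curved S (conformal_metric u \<sigma>) \<and> area M S (conformal_metric u \<sigma>) M = ennreal A"
      and x: "x \<in> M"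
    have adm: "admissible u" using u by (simp add: admissible_def)
    \<comment> \<open>The maximum point varies with \<open>u\<close>, but it always lies in one of
      the finitely many sets \<open>N p\<close> with \<open>p\<close> in \<open>F\<close>.\<close>
    obtain m where m: "m \<in> M" "\<forall>y\<in>M. u y \<le> u m"
      using continuous_attains_sup[OF M(1) _ smooth_function_continuous_on[OF M(2)]] x u by blast
    obtain p where p: "p \<in> F" "m \<in> N p" using D(3) F m by auto
    have "u x \<le> u m" using m x by blast
    also have "\<dots> \<le> C p" using C adm p m F by blast
    also have "\<dots> \<le> (\<Sum>p\<in>F. C p)" using C0 F p by (intro member_le_sum) auto
    finally show "u x \<le> 1 + (\<Sum>p\<in>F. C p)" by simp
  qed
qed

end
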